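(* $\mu(3,1,3)\geq 22$ and $\mu(3,1,4)\geq 19$.
   Context: A literal is a propositional variable $x$ or its negation $\overline{x}$; a clause is a finite set of literals not containing both a literal and its negation; a CNF formula is a finite set of clauses. A $(k,p,q)$-formula is a CNF formula in which every clause contains exactly $k$ distinct literals and every variable occurs positively in at most $p$ clauses and negatively in at most $q$ clauses. $\mu(k,p,q)$ denotes the number of clauses of a smallest unsatisfiable $(k,p,q)$-formula ($\infty$ if none exists). *)

theory Defs
  imports Main "HOL-Library.Extended_Nat"
begin

datatype 'v lit = Pos 'v | Neg 'v

definition is_clause :: "'v lit set \<Rightarrow> bool" where
  "is_clause C \<longleftrightarrow> finite C \<and> \<not> (\<exists>x. Pos x \<in> C \<and> Neg x \<in> C)"

definition is_cnf :: "'v lit set set \<Rightarrow> bool" where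
  "is_cnf F \<longleftrightarrow> finite F \<and> (\<forall>C\<in>F. is_clause C)"

fun lit_true :: "('v \<Rightarrow> bool) \<Rightarrow> 'v lit \<Rightarrow> bool" where
  "lit_true \<tau> (Pos x) \<longleftrightarrow> \<tau> x"
| "lit_true \<tau> (Neg x) \<longleftrightarrow> \<not> \<tau> x"

definition satisfiable :: "'v lit set set \<Rightarrow> bool" where
  "satisfiable F \<longleftrightarrow> (\<exists>\<tau>. \<forall>C\<in>F. \<exists>l\<in>C. lit_true \<tau> l)"

definition kpq_formula :: "nat \<Rightarrow> nat \<Rightarrow> nat \<Rightarrow> 'v lit set set \<Rightarrow> bool" where
  "kpq_formula k p q F \<longleftrightarrow> is_cnf F \<and> (\<forall>C\<in>F. card C = k) \<and>
     (\<forall>x. card {C \<in> F. Pos x \<in> C} \<le> p \<and> card {C \<in> F. Neg x \<in> C} \<le> q)"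

(* The propositional variables are the natural numbers: every formula is finite, so any
   countably infinite supply of variables gives the same values.  The infimum of a nonempty
   set of extended naturals is its minimum, and the infimum of the empty set is \<infinity>. *)
definition \<mu> :: "nat \<Rightarrow> nat \<Rightarrow> nat \<Rightarrow> enat" where
  "\<mu> k p q = Inf {enat (card F) | F :: nat lit set set. kpq_formula k p q F \<and> \<not> satisfiable F}"

end

theory Submission
  imports Defs "HOL-Library.FuncSet" Complex_Main
begin

text \<open>
  Read a clause as an implication from the conjunction of its negated variables to the disjunction
  of its positive ones; as \<open>p = 1\<close>, a variable is concluded by at most one clause, its parent. If every
  clause with positive variables commits to one of them, the least model of the resulting Horn
  clauses must violate an all-negative clause \<open>D\<close>. As parents are unique, a derivation of \<open>D\<close>
  uses the same variables for all choices, so the probability that a random choice triggers a clause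
  is the product of the reciprocals of the numbers of options at the ancestors of the clause.
  Weighting a clause by the inverse of that probability, the number of clauses is at least the
  average over all choices of the total weight of the triggered clauses, and the few occurrences
  per variable force every derivation of a violated clause to be heavy.

  The uniform distribution is not good enough: some variables \<open>x\<close> have an alternative \<open>a\<close> that is
  refuted very cheaply. Such an alternative is never chosen, which is harmless since its refutation
  uses up the occurrences of \<open>x\<close>. For \<open>q = 3\<close> one further cheap pattern remains, which involves two
  variables of all-positive clauses; it is rare enough for the average to exceed 21.
\<close>

section \<open>Clauses as rules, and occurrence bounds\<close>

definition pvars :: "'v lit set \<Rightarrow> 'v set" where
  "pvars C = {x. Pos x \<in> C}"

definition nvars :: "'v lit set \<Rightarrow> 'v set" where
  "nvars C = {x. Neg x \<in> C}"

text \<open>Forgetting the coordinates in \<open>J\<close> is injective on the functions with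
  prescribed values there and lands in the product over \<open>I - J\<close>. Only an inequality,
  since some \<open>v i\<close> may lie outside \<open>A i\<close>.\<close>

lemma card_PiE_fixed:
  assumes "finite I" "\<And>i. i \<in> I \<Longrightarrow> finite (A i)" "J \<subseteq> I"
  shows "card {c \<in> PiE I A. \<forall>i\<in>J. c i = v i} * (\<Prod>i\<in>J. card (A i)) \<le> card (PiE I A)"
proof -
  let ?S = "{c \<in> PiE I A. \<forall>i\<in>J. c i = v i}"
  have "inj_on (\<lambda>c. restrict c (I - J)) ?S"
  proof (rule inj_onI)
    fix c d assume c: "c \<in> ?S" and d: "d \<in> ?S" and e: "restrict c (I - J) = restrict d (I - J)"
    have "c i = d i" if "i \<in> I" for i
    proof (cases "i \<in> J")
      case False
      then show ?thesis using e \<open>i \<in> I\<close> by (metis DiffI restrict_apply')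
    qed (use c d in auto)
    then show "c = d" using c d by (auto intro: PiE_ext)
  qed
  moreover have "(\<lambda>c. restrict c (I - J)) ` ?S \<subseteq> PiE (I - J) A" by (auto simp: PiE_iff extensional_def split: if_splits)
  moreover have "finite (PiE (I - J) A)" using assms by (intro finite_PiE) auto
  ultimately have "card ?S \<le> card (PiE (I - J) A)" by (rule card_inj_on_le)
  also have "\<dots> = (\<Prod>i\<in>I - J. card (A i))" using assms by (subst card_PiE) auto
  finally have "card ?S * (\<Prod>i\<in>J. card (A i)) \<le> (\<Prod>i\<in>I - J. card (A i)) * (\<Prod>i\<in>J. card (A i))" by simp
  also have "\<dots> = (\<Prod>i\<in>I. card (A i))" using assms by (metis prod.subset_diff)
  finally show ?thesis using assms by (simp add: card_PiE)
qed

locale unsat_formula =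
  fixes F :: "'v lit set set" and q :: nat
  assumes kpq: "kpq_formula 3 1 q F" and unsat: "\<not> satisfiable F"
begin

lemma finite_F: "finite F"
  using kpq by (auto simp: kpq_formula_def is_cnf_def)

lemma finite_vars: "C \<in> F \<Longrightarrow> finite (pvars C)" "C \<in> F \<Longrightarrow> finite (nvars C)"
proof -
  assume "C \<in> F"
  then have f: "finite C" using kpq by (auto simp: kpq_formula_def is_cnf_def is_clause_def)
  have "pvars C = Pos -` C" "nvars C = Neg -` C" by (auto simp: pvars_def nvars_def)
  then show "finite (pvars C)" "finite (nvars C)"
    using finite_vimageI[OF f, of Pos] finite_vimageI[OF f, of Neg] by (auto simp: inj_def)
qed

lemma vars_disjoint: "C \<in> F \<Longrightarrow> x \<in> pvars C \<Longrightarrow> x \<in> nvars C \<Longrightarrow> False"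
  using kpq by (auto simp: kpq_formula_def is_cnf_def is_clause_def pvars_def nvars_def)

lemma card_vars: "C \<in> F \<Longrightarrow> card (pvars C) + card (nvars C) = 3"
proof -
  assume C: "C \<in> F"
  have eq: "C = Pos ` pvars C \<union> Neg ` nvars C"
  proof -
    have "l \<in> C \<longleftrightarrow> l \<in> Pos ` pvars C \<union> Neg ` nvars C" for l
      by (cases l) (auto simp: pvars_def nvars_def)
    then show ?thesis by blast
  qed
  have "card (Pos ` pvars C \<union> Neg ` nvars C) = card (Pos ` pvars C) + card (Neg ` nvars C)"
    using finite_vars[OF C] by (intro card_Un_disjoint) auto
  then show ?thesis using eq C kpq by (simp add: kpq_formula_def card_image inj_on_def)
qed

text \<open>This is where \<open>p = 1\<close> enters; it makes \<open>parent\<close>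
  meaningful.\<close>

lemma pvars_unique: "C \<in> F \<Longrightarrow> C' \<in> F \<Longrightarrow> x \<in> pvars C \<Longrightarrow> x \<in> pvars C' \<Longrightarrow> C = C'"
proof -
  assume a: "C \<in> F" "C' \<in> F" "x \<in> pvars C" "x \<in> pvars C'"
  have "card {C \<in> F. Pos x \<in> C} \<le> Suc 0" using kpq by (simp add: kpq_formula_def)
  moreover have "finite {C \<in> F. Pos x \<in> C}" using finite_F by simp
  ultimately show ?thesis using a by (auto simp: card_le_Suc0_iff_eq pvars_def)
qed

text \<open>The bound \<open>q\<close> in the form used for contradictions: one exhibits a list of
  more than \<open>q\<close> different clauses containing the negation of \<open>x\<close>.\<close>

lemma nvars_occ:
  assumes "distinct Cs" "set Cs \<subseteq> F" "\<And>C. C \<in> set Cs \<Longrightarrow> x \<in> nvars C"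
  shows "length Cs \<le> q"
proof -
  have "length Cs = card (set Cs)" using assms(1) by (simp add: distinct_card)
  also have "\<dots> \<le> card {C \<in> F. Neg x \<in> C}"
    using assms finite_F by (intro card_mono) (auto simp: nvars_def)
  also have "\<dots> \<le> q" using kpq by (simp add: kpq_formula_def)
  finally show ?thesis .
qed

section \<open>Roots, parents and the cheap patterns\<close>

definition root_var :: "'v \<Rightarrow> bool" where
  "root_var x \<longleftrightarrow> (\<exists>C\<in>F. x \<in> pvars C \<and> nvars C = {})"

definition parent :: "'v \<Rightarrow> 'v lit set" where
  "parent x = (THE C. C \<in> F \<and> x \<in> pvars C)"

lemma parent_eq: "C \<in> F \<Longrightarrow> x \<in> pvars C \<Longrightarrow> parent x = C"
  unfolding parent_def by (rule the_equality) (auto dest: pvars_unique)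

lemma root_var_iff: "C \<in> F \<Longrightarrow> x \<in> pvars C \<Longrightarrow> root_var x \<longleftrightarrow> nvars C = {}"
  unfolding root_var_def by (metis pvars_unique)

text \<open>The pattern \<open>x \<and> y \<rightarrow> z\<close>, \<open>\<not> (x \<and> y \<and> z)\<close>, the only one that remains too light for \<open>q = 3\<close>.\<close>

definition Cpair :: "'v \<Rightarrow> 'v \<Rightarrow> bool" where
  "Cpair x y \<longleftrightarrow> x \<noteq> y \<and> root_var x \<and> root_var y \<and>
     (\<exists>z. \<exists>E\<in>F. \<exists>E'\<in>F. nvars E = {x, y} \<and> z \<in> pvars E \<and> pvars E' = {} \<and> nvars E' = {x, y, z})"

text \<open>The alternative \<open>a\<close> of \<open>x \<rightarrow> a \<or> b\<close> is refuted by \<open>x \<and> a \<rightarrow> z\<close>, \<open>\<not> (x \<and> a \<and> z)\<close>.\<close>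

definition bad_seq :: "'v \<Rightarrow> 'v \<Rightarrow> bool" where
  "bad_seq x a \<longleftrightarrow> root_var x \<and> (\<exists>C\<in>F. nvars C = {x} \<and> a \<in> pvars C) \<and>
     (\<exists>z. \<exists>E\<in>F. \<exists>E'\<in>F. nvars E = {x, a} \<and> z \<in> pvars E \<and> pvars E' = {} \<and> nvars E' = {x, a, z})"

text \<open>The clauses \<open>x \<rightarrow> a \<or> b\<close>, \<open>x \<rightarrow> e \<or> f\<close>, \<open>\<not> (x \<and> a \<and> e)\<close>; pruning both \<open>a\<close> and \<open>e\<close> would make
  the other alternatives too light, hence at most one bad variable per \<open>x\<close> is declared dead below.\<close>

definition bad_par :: "'v \<Rightarrow> 'v \<Rightarrow> bool" where
  "bad_par x a \<longleftrightarrow> root_var x \<and> (\<exists>C\<in>F. \<exists>C'\<in>F. \<exists>e. C \<noteq> C' \<and> nvars C = {x} \<and> a \<in> pvars C \<and>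
     nvars C' = {x} \<and> e \<in> pvars C' \<and> (\<exists>E\<in>F. pvars E = {} \<and> nvars E = {x, a, e}))"

end

section \<open>Dead alternatives, choices and the least model\<close>

text \<open>The relation \<open>bad\<close> is a parameter because the two bounds prune different
  patterns: \<open>bad_seq\<close> alone for 19, \<open>bad_seq\<close> or \<open>bad_par\<close>
  for 22.\<close>

locale pruned_formula = unsat_formula F q for F :: "'v lit set set" and q :: nat +
  fixes bad :: "'v \<Rightarrow> 'v \<Rightarrow> bool"
  assumes bad: "bad x a \<Longrightarrow> root_var x \<and> (\<exists>C\<in>F. nvars C = {x} \<and> a \<in> pvars C)"
begin

text \<open>\<open>SOME\<close> selects a single bad alternative per root, so that no clause can
  lose all its options.\<close>

definition Dead :: "'v set" where
  "Dead = {a. \<exists>x. bad x a \<and> a = (SOME a. bad x a)}"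

lemma dead_dest:
  assumes "a \<in> Dead"
  obtains x where "bad x a" "root_var x" "nvars (parent a) = {x}" "parent a \<in> F" "a \<in> pvars (parent a)" "a = (SOME a. bad x a)"
proof -
  obtain x where x: "bad x a" "a = (SOME a. bad x a)" using assms by (auto simp: Dead_def)
  then obtain C where "C \<in> F" "nvars C = {x}" "a \<in> pvars C" "root_var x" using bad by blast
  moreover then have "parent a = C" by (simp add: parent_eq)
  ultimately show ?thesis using x that by blast
qed

lemma dead_unique: "a \<in> Dead \<Longrightarrow> a' \<in> Dead \<Longrightarrow> nvars (parent a) = nvars (parent a') \<Longrightarrow> a = a'"
  by (metis dead_dest singleton_inject)

lemma bad_dead: "bad x a \<Longrightarrow> \<exists>a'\<in>Dead. bad x a'"
  unfolding Dead_def by (metis (mono_tags, lifting) mem_Collect_eq someI)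

definition opts :: "'v lit set \<Rightarrow> 'v set" where
  "opts C = pvars C - Dead"

definition choices :: "('v lit set \<Rightarrow> 'v) set" where
  "choices = PiE {C \<in> F. pvars C \<noteq> {}} opts"

inductive true_var :: "('v lit set \<Rightarrow> 'v) \<Rightarrow> 'v \<Rightarrow> bool" for c where
  "C \<in> F \<Longrightarrow> pvars C \<noteq> {} \<Longrightarrow> \<forall>y\<in>nvars C. true_var c y \<Longrightarrow> true_var c (c C)"

definition T :: "('v lit set \<Rightarrow> 'v) \<Rightarrow> 'v set" where
  "T c = {y. true_var c y}"

text \<open>The parent of a dead variable has exactly one premise \<open>x\<close>, hence two
  conclusions; two dead conclusions would both be the one selected for \<open>x\<close>.\<close>

lemma dead_pvars: "C \<in> F \<Longrightarrow> a \<in> pvars C \<Longrightarrow> a \<in> Dead \<Longrightarrow> card (pvars C) = 2 \<and> pvars C \<inter> Dead = {a}"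
proof -
  assume C: "C \<in> F" "a \<in> pvars C" "a \<in> Dead"
  then have b: "parent a = C" by (simp add: parent_eq)
  then obtain x where "nvars C = {x}" using C dead_dest by metis
  then have "card (pvars C) = 2" using card_vars[of C] C by simp
  moreover have "a' = a" if "a' \<in> pvars C" "a' \<in> Dead" for a'
    using that C b dead_unique parent_eq by metis
  ultimately show ?thesis using C by blast
qed

lemma opts_nonempty: "C \<in> F \<Longrightarrow> pvars C \<noteq> {} \<Longrightarrow> opts C \<noteq> {}"
proof
  assume C: "C \<in> F" "pvars C \<noteq> {}" "opts C = {}"
  then obtain a where a: "a \<in> pvars C" "a \<in> Dead" by (auto simp: opts_def)
  then have "card (pvars C) = 2" "pvars C \<inter> Dead = {a}" using dead_pvars C by auto
  moreover have "pvars C \<subseteq> Dead" using C by (auto simp: opts_def)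
  ultimately show False by (simp add: Int_absorb2)
qed

lemma finite_opts: "C \<in> F \<Longrightarrow> finite (opts C)"
  using finite_vars by (simp add: opts_def)

lemma finite_choices: "finite choices"
  unfolding choices_def using finite_F finite_opts by (intro finite_PiE) auto

lemma choices_nonempty: "choices \<noteq> {}"
  unfolding choices_def using opts_nonempty by (simp add: PiE_eq_empty_iff)

lemma T_dest:
  assumes "c \<in> choices" "y \<in> T c"
  shows "parent y \<in> F" "y \<in> pvars (parent y)" "y \<in> opts (parent y)" "c (parent y) = y"
    "nvars (parent y) \<subseteq> T c" "y \<notin> Dead" "root_var y \<longleftrightarrow> nvars (parent y) = {}"
proof -
  have "true_var c y" using assms by (simp add: T_def)
  then obtain C where C: "C \<in> F" "pvars C \<noteq> {}" "\<forall>y\<in>nvars C. true_var c y" "y = c C"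
    by (metis true_var.cases)
  then have "y \<in> opts C" using assms by (auto simp: choices_def)
  then have "y \<in> pvars C" "y \<notin> Dead" by (auto simp: opts_def)
  then have "parent y = C" using C by (simp add: parent_eq)
  then show "parent y \<in> F" "y \<in> pvars (parent y)" "y \<in> opts (parent y)" "c (parent y) = y"
    "nvars (parent y) \<subseteq> T c" "y \<notin> Dead" "root_var y \<longleftrightarrow> nvars (parent y) = {}"
    using C \<open>y \<in> opts C\<close> \<open>y \<in> pvars C\<close> \<open>y \<notin> Dead\<close> by (auto simp: T_def root_var_iff)
qed

lemma T_intro: "C \<in> F \<Longrightarrow> pvars C \<noteq> {} \<Longrightarrow> nvars C \<subseteq> T c \<Longrightarrow> c C \<in> T c"
  unfolding T_def by (auto intro!: true_var.intros)

text \<open>Truth in the least model has no circular justification: if every member of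
  \<open>Z\<close> had a premise in \<open>Z\<close>, induction on derivations would show that no
  true variable lies in \<open>Z\<close>.\<close>

lemma T_minimal:
  assumes "c \<in> choices" "Z \<subseteq> T c" "Z \<noteq> {}"
  shows "\<exists>y\<in>Z. nvars (parent y) \<inter> Z = {}"
proof (rule ccontr)
  assume n: "\<not> ?thesis"
  have "y \<notin> Z" if "true_var c y" for y
    using that
  proof (induction)
    case (1 C)
    show ?case
    proof
      assume z: "c C \<in> Z"
      then have "c C \<in> pvars C" using 1 assms by (auto simp: choices_def opts_def)
      then have "parent (c C) = C" using 1 by (simp add: parent_eq)
      then have "nvars (parent (c C)) \<inter> Z = {}" using 1 by auto
      then show False using n z by blast
    qed
  qed
  then show False using assms by (auto simp: T_def)
qed

text \<open>The least model satisfies every clause with a positive variable, because either a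
  premise is false or the chosen conclusion is true. Unsatisfiability thus has to show at an
  all-negative clause.\<close>

lemma ex_violated_clause: "\<exists>D\<in>F. pvars D = {} \<and> nvars D \<subseteq> T c" if "c \<in> choices"
proof (rule ccontr)
  assume n: "\<not> ?thesis"
  have "\<exists>l\<in>C. lit_true (true_var c) l" if C: "C \<in> F" for C
  proof (cases "nvars C \<subseteq> T c")
    case True
    then have p: "pvars C \<noteq> {}" using n C by blast
    have "c C \<in> pvars C" using \<open>c \<in> choices\<close> C p by (auto simp: choices_def opts_def)
    moreover have "c C \<in> T c" using T_intro C p True by blast
    ultimately show ?thesis by (intro bexI[of _ "Pos (c C)"]) (auto simp: T_def pvars_def)
  next
    case False
    then obtain y where "y \<in> nvars C" "y \<notin> T c" by blast
    then show ?thesis by (intro bexI[of _ "Neg y"]) (auto simp: T_def nvars_def)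
  qed
  then show False using unsat unfolding satisfiable_def by blast
qed

section \<open>Weights and averaging over the choices\<close>

text \<open>A clause that no choice triggers, because of a dead variable, is charged to the choices that
  make its roots true.\<close>

definition trigger :: "'v lit set \<Rightarrow> 'v set" where
  "trigger C = (if \<exists>c\<in>choices. nvars C \<subseteq> T c then nvars C else {x \<in> nvars C. root_var x})"

text \<open>The reciprocal of the probability that a uniformly random choice triggers
  \<open>C\<close>. If none does, division by zero gives 0, which keeps \<open>sum_load_le\<close>
  valid.\<close>

definition weight :: "'v lit set \<Rightarrow> real" where
  "weight C = card choices / card {c \<in> choices. trigger C \<subseteq> T c}"

text \<open>A semantic substitute for the ancestors of \<open>C\<close>: by uniqueness of parents it
  is closed under passing to premises (\<open>forced_closed\<close>), so derivations need not be
  formalised as objects.\<close>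

definition forced :: "'v lit set \<Rightarrow> 'v set" where
  "forced C = {y. \<forall>c\<in>choices. trigger C \<subseteq> T c \<longrightarrow> y \<in> T c}"

definition active :: "('v lit set \<Rightarrow> 'v) \<Rightarrow> 'v lit set set" where
  "active c = {C \<in> F. trigger C \<subseteq> T c}"

definition load :: "('v lit set \<Rightarrow> 'v) \<Rightarrow> real" where
  "load c = sum weight (active c)"

abbreviation branching :: "'v \<Rightarrow> nat" where
  "branching y \<equiv> card (opts (parent y))"

lemma branching_root_var: "root_var y \<Longrightarrow> branching y = 3"
proof -
  assume "root_var y"
  then obtain C where C: "C \<in> F" "y \<in> pvars C" "nvars C = {}" by (auto simp: root_var_def)
  then have 3: "card (pvars C) = 3" using card_vars[of C] by simp
  then have "pvars C \<inter> Dead = {}" using dead_pvars[OF C(1)] by force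
  then show ?thesis using 3 parent_eq[OF C(1,2)] by (simp add: opts_def Diff_triv)
qed

text \<open>A choice that makes \<open>y\<close> true must select \<open>y\<close> at its only
  parent. Variables true under the same \<open>c\<close> have different parents, so \<open>J\<close>
  prescribes one coordinate for each of its members.\<close>

lemma card_T_fixed:
  assumes "c \<in> choices" "J \<subseteq> T c"
  shows "card {c' \<in> choices. J \<subseteq> T c'} * (\<Prod>y\<in>J. branching y) \<le> card choices"
proof -
  have inj: "inj_on parent J" using assms T_dest(4) by (metis inj_on_inverseI subset_iff)
  \<comment> \<open>\<open>v\<close> inverts \<open>parent\<close> on \<open>J\<close>: it gives the
    value prescribed at a parent clause.\<close>
  define v where "v B = (THE y. y \<in> J \<and> parent y = B)" for B
  have v: "v (parent y) = y" if "y \<in> J" for y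
    unfolding v_def using that inj by (auto simp: inj_on_def)
  let ?I = "{C \<in> F. pvars C \<noteq> {}}"
  have J: "parent ` J \<subseteq> ?I" using assms T_dest by blast
  have "{c' \<in> choices. J \<subseteq> T c'} \<subseteq> {c \<in> PiE ?I opts. \<forall>B\<in>parent ` J. c B = v B}"
  proof
    fix c' assume c': "c' \<in> {c' \<in> choices. J \<subseteq> T c'}"
    then have "c' (parent y) = y" if "y \<in> J" for y using that T_dest(4) by blast
    then show "c' \<in> {c \<in> PiE ?I opts. \<forall>B\<in>parent ` J. c B = v B}"
      using c' v by (auto simp: choices_def)
  qed
  moreover have "finite {c \<in> PiE ?I opts. \<forall>B\<in>parent ` J. c B = v B}"
    using finite_choices by (simp add: choices_def)
  ultimately have "card {c' \<in> choices. J \<subseteq> T c'} \<le> card {c \<in> PiE ?I opts. \<forall>B\<in>parent ` J. c B = v B}"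
    by (intro card_mono)
  then have "card {c' \<in> choices. J \<subseteq> T c'} * (\<Prod>y\<in>J. branching y) \<le>
     card {c \<in> PiE ?I opts. \<forall>B\<in>parent ` J. c B = v B} * (\<Prod>B\<in>parent ` J. card (opts B))"
    using inj by (simp add: prod.reindex)
  also have "\<dots> \<le> card (PiE ?I opts)"
    using J finite_F finite_opts by (intro card_PiE_fixed) auto
  finally show ?thesis by (simp add: choices_def)
qed

text \<open>All choices that trigger \<open>C\<close> make \<open>J\<close> true, and
  \<open>card_T_fixed\<close> bounds their number. Any few known ancestors therefore give a lower
  bound, without knowing the whole derivation.\<close>

lemma weight_ge:
  assumes "c \<in> choices" "C \<in> active c" "J \<subseteq> forced C"
  shows "real (\<Prod>y\<in>J. branching y) \<le> weight C"
proof -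
  have J: "J \<subseteq> T c" using assms by (auto simp: forced_def active_def)
  let ?E = "{c \<in> choices. trigger C \<subseteq> T c}"
  have "?E \<subseteq> {c' \<in> choices. J \<subseteq> T c'}" using assms by (auto simp: forced_def)
  then have "card ?E \<le> card {c' \<in> choices. J \<subseteq> T c'}" using finite_choices by (intro card_mono) auto
  then have "card ?E * (\<Prod>y\<in>J. branching y) \<le> card choices"
    using card_T_fixed[OF assms(1) J] by (meson le_trans mult_le_mono1)
  moreover have "card ?E > 0"
    using assms finite_choices by (auto simp: card_gt_0_iff active_def)
  moreover have "real (card ?E) * real (\<Prod>y\<in>J. branching y) \<le> card choices"
    using calculation(1) by (simp only: of_nat_mult[symmetric] of_nat_le_iff)
  ultimately show ?thesis unfolding weight_def by (simp add: pos_le_divide_eq mult.commute)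
qed

text \<open>Double counting: summed over the choices that trigger it, a clause contributes
  \<open>card choices\<close>, or 0 if it is never triggered.\<close>

lemma sum_load_le: "(\<Sum>c\<in>choices. load c) \<le> card choices * card F"
proof -
  have "(\<Sum>c\<in>choices. load c) = (\<Sum>c\<in>choices. \<Sum>C | C \<in> F \<and> trigger C \<subseteq> T c. weight C)"
    by (simp add: load_def active_def)
  also have "\<dots> = (\<Sum>C\<in>F. \<Sum>c | c \<in> choices \<and> trigger C \<subseteq> T c. weight C)"
    using finite_choices finite_F by (rule sum.swap_restrict)
  also have "\<dots> \<le> (\<Sum>C\<in>F. real (card choices))"
    by (intro sum_mono) (simp add: weight_def)
  finally show ?thesis by (simp add: mult.commute)
qed

lemma card_F_ge:
  assumes "\<And>c. c \<in> choices \<Longrightarrow> r \<le> load c"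
  shows "r \<le> card F"
proof -
  have "card choices * r \<le> (\<Sum>c\<in>choices. load c)" using assms by (simp add: sum_bounded_below)
  then have "card choices * r \<le> card choices * card F" using sum_load_le by linarith
  moreover have "card choices > 0" using finite_choices choices_nonempty by (simp add: card_gt_0_iff)
  ultimately show ?thesis by simp
qed

end

section \<open>Derivation of a violated clause: basic estimates\<close>

locale violated_clause = pruned_formula F q bad for F :: "'v lit set set" and q :: nat and bad +
  fixes c D
  assumes c: "c \<in> choices" and D: "D \<in> F" "pvars D = {}" "nvars D \<subseteq> T c"
begin

abbreviation "A \<equiv> forced D"

lemma active_iff: "C \<in> F \<Longrightarrow> nvars C \<subseteq> T c \<Longrightarrow> C \<in> active c"
  using c by (auto simp: active_def trigger_def)

lemma forced_nvars: "nvars C \<subseteq> T c \<Longrightarrow> nvars C \<subseteq> forced C"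
  using c by (auto simp: forced_def trigger_def)

lemma forced_closed: "y \<in> forced C \<Longrightarrow> nvars (parent y) \<subseteq> forced C"
  using T_dest(5) unfolding forced_def by blast

lemma forced_T: "C \<in> active c \<Longrightarrow> forced C \<subseteq> T c"
  using c by (auto simp: forced_def active_def)

lemma trigger_eq: "nvars C \<subseteq> T c \<Longrightarrow> trigger C = nvars C"
  using c by (auto simp: trigger_def)

lemma forced_trans: "nvars C \<subseteq> T c \<Longrightarrow> nvars C \<subseteq> forced C' \<Longrightarrow> forced C \<subseteq> forced C'"
  unfolding forced_def trigger_eq by blast

lemma D_active: "D \<in> active c" using D active_iff by blast

lemma A_T: "A \<subseteq> T c" using D_active forced_T by blast

lemma D_A: "nvars D \<subseteq> A" using D forced_nvars by blast

lemma card_D: "card (nvars D) = 3" using card_vars[of D] D by simp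

lemma parent_active: "y \<in> T c \<Longrightarrow> parent y \<in> active c"
  using active_iff T_dest c by blast

lemma parent_inj: "y \<in> T c \<Longrightarrow> z \<in> T c \<Longrightarrow> parent y = parent z \<longleftrightarrow> y = z"
  using T_dest(4) c by metis

lemma parent_D: "y \<in> T c \<Longrightarrow> parent y \<noteq> D"
  using T_dest(2) c D by blast

lemma load_list: "distinct Cs \<Longrightarrow> set Cs \<subseteq> active c \<Longrightarrow> sum_list (map weight Cs) \<le> load c"
proof -
  assume a: "distinct Cs" "set Cs \<subseteq> active c"
  have "sum_list (map weight Cs) = sum weight (set Cs)" using a by (simp add: sum_list_distinct_conv_sum_set)
  also have "\<dots> \<le> load c" unfolding load_def
    using a finite_F by (intro sum_mono2) (auto simp: active_def weight_def)
  finally show ?thesis .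
qed

lemma branching_p2: "y \<in> T c \<Longrightarrow> card (nvars (parent y)) = 1 \<Longrightarrow> pvars (parent y) \<inter> Dead = {} \<Longrightarrow> branching y = 2"
  using card_vars[OF T_dest(1)[OF c, of y]] by (simp add: opts_def Diff_triv)

lemma weight_ge_1: "C \<in> active c \<Longrightarrow> 1 \<le> weight C"
  using weight_ge[OF c, of C "{}"] by simp

lemma weight_forced1: "C \<in> active c \<Longrightarrow> x \<in> forced C \<Longrightarrow> real (branching x) \<le> weight C"
  using weight_ge[OF c, of C "{x}"] by simp

lemma weight_forced2: "C \<in> active c \<Longrightarrow> x \<in> forced C \<Longrightarrow> y \<in> forced C \<Longrightarrow> x \<noteq> y \<Longrightarrow> real (branching x) * real (branching y) \<le> weight C"
  using weight_ge[OF c, of C "{x,y}"] by simp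

lemma weight_forced3: "C \<in> active c \<Longrightarrow> x \<in> forced C \<Longrightarrow> y \<in> forced C \<Longrightarrow> z \<in> forced C \<Longrightarrow> distinct [x,y,z] \<Longrightarrow>
    real (branching x) * (real (branching y) * real (branching z)) \<le> weight C"
  using weight_ge[OF c, of C "{x,y,z}"] by simp

text \<open>Explores a derivation step by step: with the ancestors in \<open>X\<close> already
  known, there is a further one whose premises are all in \<open>X\<close>. It comes from
  \<open>T_minimal\<close> applied to \<open>forced C - X\<close>.\<close>

lemma forced_minimal:
  assumes "C \<in> active c" "\<not> forced C \<subseteq> X"
  obtains g where "g \<in> forced C" "g \<notin> X" "nvars (parent g) \<subseteq> X"
proof -
  have "forced C - X \<subseteq> T c" "forced C - X \<noteq> {}" using assms forced_T by auto
  then obtain g where "g \<in> forced C - X" "nvars (parent g) \<inter> (forced C - X) = {}" using T_minimal c by metis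
  then show ?thesis using that forced_closed by blast
qed

text \<open>A derivation of the premises has to start at some root, and a root has three
  options.\<close>

lemma weight_nonpos:
  assumes "C \<in> F" "nvars C \<subseteq> T c" "nvars C \<noteq> {}"
  shows "3 \<le> weight C"
proof -
  have a: "C \<in> active c" using assms active_iff by blast
  have "\<not> forced C \<subseteq> {}" using forced_nvars assms by blast
  then obtain g where g: "g \<in> forced C" "nvars (parent g) \<subseteq> {}" using forced_minimal a by metis
  then have "g \<in> T c" using forced_T a by blast
  then have "branching g = 3" using branching_root_var T_dest(7)[OF c] g by blast
  then show ?thesis using weight_forced1[OF a g(1)] by simp
qed

lemma weight_parent: "y \<in> T c \<Longrightarrow> \<not> root_var y \<Longrightarrow> 3 \<le> weight (parent y)"
  using weight_nonpos[of "parent y"] T_dest(1,5,7)[OF c, of y] by simp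

lemma card_nvars_parent:
  assumes "y \<in> T c" "\<not> root_var y"
  shows "card (nvars (parent y)) = 1 \<or> card (nvars (parent y)) = 2"
proof -
  note t = T_dest[OF c assms(1)]
  have "card (pvars (parent y)) > 0" using t finite_vars by (metis card_gt_0_iff empty_iff)
  moreover have "card (nvars (parent y)) > 0" using t finite_vars assms by (metis card_gt_0_iff)
  ultimately show ?thesis using card_vars[OF t(1)] by linarith
qed

section \<open>Extra clauses gained from dead variables\<close>

lemma dead_sibling:
  assumes "g \<in> T c" "pvars (parent g) \<inter> Dead \<noteq> {}"
  obtains x a where "a \<in> Dead" "bad x a" "parent a = parent g" "nvars (parent g) = {x}" "root_var x" "x \<in> T c"
proof -
  obtain a where a: "a \<in> Dead" "a \<in> pvars (parent g)" using assms by auto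
  have "parent a = parent g" using a T_dest(1)[OF c assms(1)] by (simp add: parent_eq)
  moreover obtain x where "bad x a" "root_var x" "nvars (parent a) = {x}" using a dead_dest by metis
  ultimately show ?thesis using that a T_dest(5)[OF c assms(1)] by force
qed

lemma dead_not_parent: "a \<in> Dead \<Longrightarrow> a \<in> nvars E \<Longrightarrow> h \<in> T c \<Longrightarrow> parent h \<noteq> E"
  using T_dest(5)[OF c, of h] T_dest(6)[OF c, of a] by auto

text \<open>A clause with a dead premise is never triggered by true premises, so it is charged to
  its root \<open>x\<close>. Since dead variables are never true, it differs from \<open>D\<close>
  and from every parent of a true variable and can be added to the load.\<close>

lemma dead_clause:
  assumes "E \<in> F" "a \<in> Dead" "a \<in> nvars E" "{y \<in> nvars E. root_var y} = {x}" "x \<in> T c"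
  shows "E \<in> active c" "3 \<le> weight E" "E \<noteq> D" "\<forall>h\<in>T c. parent h \<noteq> E \<and> E \<noteq> parent h"
proof -
  have "\<not> (\<exists>c\<in>choices. nvars E \<subseteq> T c)" using assms T_dest(6) by blast
  then have trigger: "trigger E = {x}" using assms by (simp add: trigger_def)
  then show active: "E \<in> active c" using assms by (simp add: active_def)
  have "x \<in> forced E" by (simp add: forced_def trigger)
  moreover have "root_var x" using assms by blast
  ultimately show "3 \<le> weight E" using weight_forced1[OF active] branching_root_var[of x] assms by force
  show "E \<noteq> D" using assms D T_dest(6)[OF c] by blast
  show "\<forall>h\<in>T c. parent h \<noteq> E \<and> E \<noteq> parent h" using assms dead_not_parent by blast
qed

text \<open>The compensation for pruning \<open>a\<close>: two additional clauses of weight at least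
  3, both using up an occurrence of the negation of \<open>x\<close>. As \<open>a\<close> and
  \<open>z\<close> are not roots, \<open>x\<close> is the only root premise.\<close>

lemma bad_seq_clauses:
  assumes "bad_seq x a" "a \<in> Dead" "x \<in> T c"
  obtains E E' where "E \<in> active c" "E' \<in> active c" "E \<noteq> E'" "3 \<le> weight E" "3 \<le> weight E'" "E \<noteq> D" "E' \<noteq> D"
    "\<forall>h\<in>T c. parent h \<noteq> E \<and> E \<noteq> parent h" "\<forall>h\<in>T c. parent h \<noteq> E' \<and> E' \<noteq> parent h"
    "x \<in> nvars E" "x \<in> nvars E'" "a \<in> nvars E" "a \<in> nvars E'" "E \<in> F" "E' \<in> F"
proof -
  obtain C z E E' where C: "C \<in> F" "nvars C = {x}" "a \<in> pvars C" "root_var x" and E: "E \<in> F" "E' \<in> F"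
    "nvars E = {x, a}" "z \<in> pvars E" "pvars E' = {}" "nvars E' = {x, a, z}"
    using assms by (auto simp: bad_seq_def)
  have "\<not> root_var a" using root_var_iff[of C a] C by simp
  moreover have "\<not> root_var z" using root_var_iff[of E z] E by simp
  ultimately have p: "{y \<in> nvars E. root_var y} = {x}" "{y \<in> nvars E'. root_var y} = {x}" using C E by auto
  have "E \<noteq> E'" using E by auto
  then show ?thesis
    using that dead_clause[OF E(1) assms(2) _ p(1) assms(3)] dead_clause[OF E(2) assms(2) _ p(2) assms(3)] E by auto
qed

text \<open>The same compensation for the parallel pattern. Here \<open>C'\<close> is an ordinary
  rule and may itself be the parent of a true variable; only \<open>E\<close> is guaranteed not to
  be.\<close>

lemma bad_par_clauses:
  assumes "bad_par x a" "a \<in> Dead" "x \<in> T c"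
  obtains C' E where "C' \<in> F" "E \<in> F" "C' \<noteq> parent a" "nvars C' = {x}" "C' \<in> active c" "3 \<le> weight C'"
    "E \<in> active c" "3 \<le> weight E" "E \<noteq> D" "\<forall>h\<in>T c. parent h \<noteq> E \<and> E \<noteq> parent h" "x \<in> nvars E" "a \<in> nvars E" "C' \<noteq> E"
proof -
  obtain C C' e E where C: "C \<in> F" "C' \<in> F" "C \<noteq> C'" "nvars C = {x}" "a \<in> pvars C" "root_var x"
     "nvars C' = {x}" "e \<in> pvars C'" and E: "E \<in> F" "pvars E = {}" "nvars E = {x, a, e}"
    using assms by (auto simp: bad_par_def)
  have "\<not> root_var a" using root_var_iff[of C a] C by simp
  moreover have "\<not> root_var e" using root_var_iff[of C' e] C by simp
  ultimately have p: "{y \<in> nvars E. root_var y} = {x}" using C E by auto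
  have "parent a = C" using C by (simp add: parent_eq)
  moreover have "C' \<in> active c" using C assms active_iff by auto
  moreover have "3 \<le> weight C'" using weight_nonpos C assms by auto
  moreover have "C' \<noteq> E" using C E by auto
  ultimately show ?thesis
    using that[of C' E] dead_clause[OF E(1) assms(2) _ p assms(3)] C E by auto
qed

section \<open>Cases shared by both bounds\<close>

lemma three_roots:
  assumes "x \<in> A" "y \<in> A" "z \<in> A" "root_var x" "root_var y" "root_var z" "distinct [x, y, z]"
  shows "27 \<le> load c"
proof -
  have "branching x = 3" "branching y = 3" "branching z = 3" using assms branching_root_var A_T by blast+
  then have "27 \<le> weight D" using weight_forced3[OF D_active, of x y z] assms by simp
  then show ?thesis using load_list[of "[D]"] D_active by simp
qed

text \<open>\<open>p2\<close> stands for a rule with one premise and two conclusions; without a dead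
  conclusion it contributes a factor 2. The load is at least 18 for \<open>D\<close>, 3 for the rule
  and 1 for each root clause.\<close>

lemma two_roots_free_p2:
  assumes "x \<in> A" "y \<in> A" "root_var x" "root_var y" "x \<noteq> y" "g \<in> A" "card (nvars (parent g)) = 1" "pvars (parent g) \<inter> Dead = {}"
  shows "23 \<le> load c"
proof -
  have t: "x \<in> T c" "y \<in> T c" "g \<in> T c" using assms A_T by auto
  have np: "\<not> root_var g" using T_dest(7)[OF c t(3)] assms(7) by auto
  then have "x \<noteq> g" "y \<noteq> g" using assms by auto
  moreover have "branching x = 3" "branching y = 3" "branching g = 2" using assms t branching_root_var branching_p2 by auto
  ultimately have "18 \<le> weight D" using weight_forced3[OF D_active, of x y g] assms by simp
  moreover have "3 \<le> weight (parent g)" using weight_parent t np by blast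
  moreover have "1 \<le> weight (parent x)" "1 \<le> weight (parent y)" using weight_ge_1 parent_active t by auto
  moreover have "distinct [D, parent g, parent x, parent y]"
    using t parent_inj parent_D[symmetric] \<open>x \<noteq> y\<close> \<open>x \<noteq> g\<close> \<open>y \<noteq> g\<close> by auto
  ultimately show ?thesis using load_list[of "[D, parent g, parent x, parent y]"] D_active parent_active t by simp
qed

lemma D_third_var: "\<exists>h\<in>nvars D. h \<noteq> u \<and> h \<noteq> v"
proof (rule ccontr)
  assume "\<not> ?thesis"
  then have "nvars D \<subseteq> {u, v}" by blast
  then have "card (nvars D) \<le> card {u, v}" by (intro card_mono) auto
  also have "\<dots> \<le> 2" by (simp add: card_insert_if)
  finally show False using card_D by simp
qed

lemma D_eq: "nvars D \<subseteq> {u, v, z} \<Longrightarrow> nvars D = {u, v, z}"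
  using card_D by (intro card_seteq) (auto simp: card_insert_if)

lemma one_root_start:
  assumes "\<And>y. y \<in> A \<Longrightarrow> root_var y \<Longrightarrow> y = x" "x \<in> A" "root_var x"
  obtains g where "g \<in> A" "g \<noteq> x" "nvars (parent g) = {x}"
proof -
  have "\<not> A \<subseteq> {x}" using D_third_var[of x x] D_A by blast
  then obtain g where g: "g \<in> A" "g \<notin> {x}" "nvars (parent g) \<subseteq> {x}" by (rule forced_minimal[OF D_active])
  then have "\<not> root_var g" using assms by blast
  then have "nvars (parent g) \<noteq> {}" using T_dest(7)[OF c, of g] g A_T by auto
  then show ?thesis using that[of g] g by blast
qed

lemma exists_root_var: obtains x where "x \<in> A" "root_var x"
proof -
  have "\<not> A \<subseteq> {}" using D_third_var[of undefined undefined] D_A by blast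
  then obtain g where g: "g \<in> A" "g \<notin> {}" "nvars (parent g) \<subseteq> {}" by (rule forced_minimal[OF D_active])
  then have "root_var g" using T_dest(7)[OF c, of g] A_T by auto
  then show ?thesis using that g by blast
qed

lemma dead_p2_unique:
  assumes "g \<in> T c" "h \<in> T c" "pvars (parent g) \<inter> Dead \<noteq> {}" "pvars (parent h) \<inter> Dead \<noteq> {}"
    "nvars (parent g) = nvars (parent h)"
  shows "g = h"
proof -
  obtain a where a: "a \<in> Dead" "parent a = parent g" using dead_sibling[OF assms(1,3)] by metis
  obtain b where b: "b \<in> Dead" "parent b = parent h" using dead_sibling[OF assms(2,4)] by metis
  have "a = b" using dead_unique a b assms(5) by simp
  then have "parent g = parent h" using a b by simp
  then show ?thesis using parent_inj assms by simp
qed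

text \<open>All-positive clauses are triggered by every choice, so each of them adds at least
  1.\<close>

lemma load_roots:
  assumes "S \<subseteq> active c" "\<And>C. C \<in> S \<Longrightarrow> nvars C \<noteq> {}"
  shows "sum weight S + card {C \<in> F. nvars C = {}} \<le> load c"
proof -
  let ?P = "{C \<in> F. nvars C = {}}"
  have P: "?P \<subseteq> active c" using active_iff by auto
  have f: "finite (active c)" using finite_F by (simp add: active_def)
  have "(\<Sum>C\<in>?P. 1) \<le> sum weight ?P" using P weight_ge_1 by (intro sum_mono) auto
  then have "real (card ?P) \<le> sum weight ?P" by simp
  moreover have "sum weight S + sum weight ?P = sum weight (S \<union> ?P)"
    using assms P f by (intro sum.union_disjoint[symmetric]) (auto intro: finite_subset)
  moreover have "sum weight (S \<union> ?P) \<le> load c"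
    unfolding load_def using assms P f by (intro sum_mono2) (auto simp: weight_def)
  ultimately show ?thesis by linarith
qed

text \<open>The first variable \<open>g\<close> beyond the roots must be concluded from both of
  them, so its parent and \<open>D\<close> each weigh at least 9. Either this is the whole
  derivation, which is the pattern \<open>Cpair\<close>, or a third clause of weight 9 gives
  27.\<close>

lemma two_roots_no_p2:
  assumes "x \<in> A" "y \<in> A" "root_var x" "root_var y" "x \<noteq> y" "\<And>z. z \<in> A \<Longrightarrow> root_var z \<Longrightarrow> z = x \<or> z = y"
    "\<And>g. g \<in> A \<Longrightarrow> card (nvars (parent g)) \<noteq> 1"
  shows "18 + card {C \<in> F. nvars C = {}} \<le> load c" "22 \<le> load c \<or> Cpair x y"
proof -
  have t: "x \<in> T c" "y \<in> T c" using assms A_T by auto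
  have branching: "branching x = 3" "branching y = 3" using t assms branching_root_var by auto
  have nine: "9 \<le> weight C" if "C \<in> active c" "x \<in> forced C" "y \<in> forced C" for C
    using weight_forced2[OF that] assms branching by simp
  have two: "card (nvars (parent g)) = 2" if "g \<in> A" "g \<noteq> x" "g \<noteq> y" for g
    using card_nvars_parent[of g] assms(6,7)[of g] that A_T by auto
  have "\<not> A \<subseteq> {x, y}" using D_third_var[of x y] D_A by blast
  then obtain g where g: "g \<in> A" "g \<notin> {x, y}" "nvars (parent g) \<subseteq> {x, y}" by (rule forced_minimal[OF D_active])
  then have gt: "g \<in> T c" using A_T by blast
  have ng: "nvars (parent g) = {x, y}"
    using g two[of g] assms by (intro card_seteq) auto
  have sub: "nvars (parent g) \<subseteq> forced (parent g)" using t ng by (intro forced_nvars) auto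
  have wg: "9 \<le> weight (parent g)" using nine[OF parent_active[OF gt]] sub ng by auto
  have wD: "9 \<le> weight D" using nine D_active assms by blast
  have nD: "nvars D \<noteq> {}" using card_D by auto
  have "sum weight {parent g, D} = weight (parent g) + weight D" using parent_D gt by simp
  moreover have "sum weight {parent g, D} + card {C \<in> F. nvars C = {}} \<le> load c"
    using parent_active gt D_active ng nD by (intro load_roots) auto
  ultimately show "18 + card {C \<in> F. nvars C = {}} \<le> load c" using wg wD by linarith
  show "22 \<le> load c \<or> Cpair x y"
  proof (cases "A \<subseteq> {x, y, g}")
    case True
    then have "nvars D = {x, y, g}" using D_A D_eq by (metis subset_trans)
    then have "Cpair x y" unfolding Cpair_def using assms ng D T_dest(1,2)[OF c gt] by blast
    then show ?thesis ..
  next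
    case False
    then obtain h where h: "h \<in> A" "h \<notin> {x, y, g}" "nvars (parent h) \<subseteq> {x, y, g}"
      by (rule forced_minimal[OF D_active])
    then have ht: "h \<in> T c" using A_T by blast
    have s: "nvars (parent h) \<subseteq> forced (parent h)" using T_dest(5)[OF c ht] by (rule forced_nvars)
    have "x \<in> forced (parent h) \<and> y \<in> forced (parent h)"
    proof (cases "g \<in> nvars (parent h)")
      case True
      then show ?thesis using s forced_closed[of g "parent h"] ng by auto
    next
      case False
      then have "nvars (parent h) = {x, y}" using h two[of h] assms by (intro card_seteq) auto
      then show ?thesis using s by auto
    qed
    then have "9 \<le> weight (parent h)" using nine parent_active ht by blast
    moreover have "distinct [D, parent g, parent h]" using h gt ht parent_inj parent_D[symmetric] by auto
    ultimately show ?thesis using load_list[of "[D, parent g, parent h]"] D_active parent_active gt ht wg wD by simp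
  qed
qed

section \<open>The load for \<open>q <= 4\<close>\<close>

text \<open>Case distinction on the roots in \<open>A\<close> and on one-premise rules with or
  without a dead alternative. With a single root every case either sums to exactly 19 or is refuted
  by five occurrences of the negation of \<open>x\<close>.\<close>

lemma load_ge_19:
  assumes q: "q \<le> 4" and bad_eq: "bad = bad_seq"
  shows "19 \<le> load c"
proof -
  obtain x where x: "x \<in> A" "root_var x" by (rule exists_root_var)
  have xt: "x \<in> T c" using x A_T by blast
  have obx: "branching x = 3" using xt x branching_root_var by blast
  show ?thesis
  proof (cases "\<exists>y\<in>A. root_var y \<and> y \<noteq> x")
    case True
    then obtain y where y: "y \<in> A" "root_var y" "y \<noteq> x" by blast
    have yt: "y \<in> T c" using y A_T by blast
    have oby: "branching y = 3" using yt y branching_root_var by blast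
    show ?thesis
    proof (cases "\<exists>z\<in>A. root_var z \<and> z \<noteq> x \<and> z \<noteq> y")
      case True
      then show ?thesis using three_roots[OF x(1) y(1) _ x(2) y(2)] y by force
    next
      case no3: False
      show ?thesis
      proof (cases "\<exists>g\<in>A. card (nvars (parent g)) = 1")
        case True
        then obtain g where g: "g \<in> A" "card (nvars (parent g)) = 1" by blast
        show ?thesis
        proof (cases "pvars (parent g) \<inter> Dead = {}")
          case True
          then show ?thesis using two_roots_free_p2[OF x(1) y(1) x(2) y(2) y(3)[symmetric] g] by simp
        next
          case False
          have gt: "g \<in> T c" using g A_T by blast
          obtain x' a where a: "a \<in> Dead" "bad x' a" "parent a = parent g" "nvars (parent g) = {x'}" "root_var x'" "x' \<in> T c"
            by (rule dead_sibling[OF gt False])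
          obtain y' where y': "y' \<in> T c" "y' \<noteq> x'" "root_var y'" using x y xt yt by metis
          obtain E E' where E: "E \<in> active c" "E' \<in> active c" "E \<noteq> E'" "3 \<le> weight E" "3 \<le> weight E'" "E \<noteq> D" "E' \<noteq> D"
            "\<forall>h\<in>T c. parent h \<noteq> E \<and> E \<noteq> parent h" "\<forall>h\<in>T c. parent h \<noteq> E' \<and> E' \<noteq> parent h"
            "x' \<in> nvars E" "x' \<in> nvars E'" "a \<in> nvars E" "a \<in> nvars E'" "E \<in> F" "E' \<in> F"
            by (rule bad_seq_clauses[OF a(2)[unfolded bad_eq] a(1,6)])
          have ng: "\<not> root_var g" using T_dest(7)[OF c gt] a by simp
          then have "g \<noteq> x'" "g \<noteq> y'" using a y' by auto
          \<comment> \<open>The sum is 1 + 3 + 1 + 3 + 3 + 9 = 20.\<close>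
          then have "distinct [parent x', parent g, parent y', E, E', D]"
            using E a(6) y' gt parent_inj parent_D by auto
          moreover have "9 \<le> weight D" using weight_forced2[OF D_active x(1) y(1)] y obx oby by simp
          moreover have "3 \<le> weight (parent g)" using weight_parent gt ng by blast
          moreover have "1 \<le> weight (parent x')" "1 \<le> weight (parent y')" using weight_ge_1 parent_active a y' by auto
          ultimately show ?thesis using load_list[of "[parent x', parent g, parent y', E, E', D]"]
            E D_active parent_active a(6) y' gt by simp
        qed
      next
        case False
        have "18 + card {C \<in> F. nvars C = {}} \<le> load c"
          using two_roots_no_p2(1)[of x y] x y no3 False by blast
        \<comment> \<open>Two roots that are true together come from different all-positive clauses,
          so the total is at least 18 + 2.\<close>
        moreover have "card {parent x, parent y} \<le> card {C \<in> F. nvars C = {}}"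
          using finite_F T_dest(1,7)[OF c xt] T_dest(1,7)[OF c yt] x y by (intro card_mono) auto
        moreover have "card {parent x, parent y} = 2" using parent_inj xt yt y by simp
        ultimately show ?thesis by linarith
      qed
    qed
  next
    case False
    then have only: "\<And>y. y \<in> A \<Longrightarrow> root_var y \<Longrightarrow> y = x" by blast
    show ?thesis
    proof (cases "\<exists>g\<in>A. pvars (parent g) \<inter> Dead \<noteq> {}")
      case True
      then obtain g where g: "g \<in> A" "pvars (parent g) \<inter> Dead \<noteq> {}" by blast
      have gt: "g \<in> T c" using g A_T by blast
      have dead_x: "nvars (parent h) = {x}" if h: "h \<in> A" "pvars (parent h) \<inter> Dead \<noteq> {}" for h
      proof -
        have ht: "h \<in> T c" using h A_T by blast
        obtain x' a where a: "a \<in> Dead" "bad x' a" "parent a = parent h" "nvars (parent h) = {x'}" "root_var x'" "x' \<in> T c"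
          by (rule dead_sibling[OF ht h(2)])
        then have "x' = x" using only forced_closed[OF h(1)] by auto
        then show ?thesis using a by simp
      qed
      have ng: "nvars (parent g) = {x}" using dead_x g by blast
      then have npg: "\<not> root_var g" using T_dest(7)[OF c gt] by simp
      obtain x' a where a': "a \<in> Dead" "bad x' a" "parent a = parent g" "nvars (parent g) = {x'}" "root_var x'" "x' \<in> T c"
        by (rule dead_sibling[OF gt g(2)])
      then have a: "a \<in> Dead" "bad_seq x a" using ng bad_eq by auto
      obtain E E' where E: "E \<in> active c" "E' \<in> active c" "E \<noteq> E'" "3 \<le> weight E" "3 \<le> weight E'" "E \<noteq> D" "E' \<noteq> D"
            "\<forall>h\<in>T c. parent h \<noteq> E \<and> E \<noteq> parent h" "\<forall>h\<in>T c. parent h \<noteq> E' \<and> E' \<noteq> parent h"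
            "x \<in> nvars E" "x \<in> nvars E'" "a \<in> nvars E" "a \<in> nvars E'" "E \<in> F" "E' \<in> F"
            by (rule bad_seq_clauses[OF a(2,1) xt])
      have w': "1 \<le> weight (parent x)" "3 \<le> weight (parent g)" using weight_ge_1 parent_active xt weight_parent gt npg by auto
      have xg: "x \<noteq> g" using x npg by auto
      show ?thesis
      proof (cases "\<exists>h\<in>A. card (nvars (parent h)) = 1 \<and> pvars (parent h) \<inter> Dead = {}")
        case True
        then obtain h where h: "h \<in> A" "card (nvars (parent h)) = 1" "pvars (parent h) \<inter> Dead = {}" by blast
        have ht: "h \<in> T c" using h A_T by blast
        have nph: "\<not> root_var h" using T_dest(7)[OF c ht] h by auto
        have "x \<noteq> h" using nph x by auto
        moreover have "g \<noteq> h" using h g by auto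
        ultimately have "distinct [parent x, parent g, E, E', parent h, D]"
          using E xt gt ht xg parent_inj parent_D by auto
        moreover have "3 \<le> weight (parent h)" using weight_parent ht nph by blast
        moreover have "6 \<le> weight D" using weight_forced2[OF D_active x(1) h(1) \<open>x \<noteq> h\<close>] obx branching_p2[OF ht h(2,3)] by simp
        ultimately show ?thesis using load_list[of "[parent x, parent g, E, E', parent h, D]"]
            E D_active parent_active xt gt ht w' by simp
      next
        case nofree: False
        have "\<not> A \<subseteq> {x, g}" using D_third_var[of x g] D_A by blast
        then obtain h where h: "h \<in> A" "h \<notin> {x, g}" "nvars (parent h) \<subseteq> {x, g}" by (rule forced_minimal[OF D_active])
        have ht: "h \<in> T c" using h A_T by blast
        have nph: "\<not> root_var h" using only h by auto
        have "card (nvars (parent h)) \<noteq> 1"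
        proof
          assume "card (nvars (parent h)) = 1"
          then have d: "pvars (parent h) \<inter> Dead \<noteq> {}" using nofree h(1) by blast
          have "g = h" using dead_p2_unique[OF gt ht g(2) d] dead_x[OF h(1) d] ng by simp
          then show False using h(2) by blast
        qed
        then have "card (nvars (parent h)) = 2" using card_nvars_parent[OF ht nph] by simp
        then have nh: "nvars (parent h) = {x, g}" using h xg by (intro card_seteq) auto
        have wh: "3 \<le> weight (parent h)" "3 \<le> weight D" using weight_parent ht nph weight_forced1[OF D_active x(1)] obx by auto
        show ?thesis
        proof (cases "A \<subseteq> {x, g, h}")
          case True
          then have nD: "nvars D = {x, g, h}" using D_A D_eq by (metis subset_trans)
          have "length [parent g, E, E', parent h, D] \<le> q"
          proof (rule nvars_occ)
            show "distinct [parent g, E, E', parent h, D]" using E gt ht h parent_inj parent_D by auto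
            show "set [parent g, E, E', parent h, D] \<subseteq> F" using E D T_dest(1)[OF c] gt ht by auto
          qed (use E nD nh ng in auto)
          then show ?thesis using q by simp
        next
          case False
          then obtain k where k: "k \<in> A" "k \<notin> {x, g, h}" by blast
          have kt: "k \<in> T c" using k A_T by blast
          have "\<not> root_var k" using only k by auto
          then have "3 \<le> weight (parent k)" using weight_parent kt by blast
          \<comment> \<open>One root clause and six further clauses of weight 3: 1 + 18 =
            19.\<close>
          moreover have "distinct [parent x, parent g, E, E', parent h, parent k, D]"
            using E xt gt ht kt h k xg parent_inj parent_D by auto
          ultimately show ?thesis using load_list[of "[parent x, parent g, E, E', parent h, parent k, D]"]
            E D_active parent_active xt gt ht kt w' wh by simp
        qed
      qed
    next
      case False
      then have nodead: "\<And>h. h \<in> A \<Longrightarrow> pvars (parent h) \<inter> Dead = {}" by blast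
      obtain g where g: "g \<in> A" "g \<noteq> x" "nvars (parent g) = {x}"
        using one_root_start[OF only x] by metis
      have gt: "g \<in> T c" using g A_T by blast
      have npg: "\<not> root_var g" using only g by blast
      have obg: "branching g = 2" using branching_p2[OF gt] g nodead by simp
      have w': "1 \<le> weight (parent x)" "3 \<le> weight (parent g)" using weight_ge_1 parent_active xt weight_parent gt npg by auto
      show ?thesis
      proof (cases "\<exists>h\<in>A. card (nvars (parent h)) = 1 \<and> h \<noteq> g")
        case True
        then obtain h where h: "h \<in> A" "card (nvars (parent h)) = 1" "h \<noteq> g" by blast
        have ht: "h \<in> T c" using h A_T by blast
        have nph: "\<not> root_var h" using T_dest(7)[OF c ht] h by auto
        have "h \<noteq> x" using nph x by auto
        have "12 \<le> weight D" using weight_forced3[OF D_active x(1) g(1) h(1)] obx obg branching_p2[OF ht h(2)] nodead h g \<open>h \<noteq> x\<close>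
          by auto
        moreover have "3 \<le> weight (parent h)" using weight_parent ht nph by blast
        moreover have "distinct [parent x, parent g, parent h, D]"
          using xt gt ht h g \<open>h \<noteq> x\<close> parent_inj parent_D by auto
        ultimately show ?thesis using load_list[of "[parent x, parent g, parent h, D]"]
            D_active parent_active xt gt ht w' by simp
      next
        case nop2: False
        have wD: "6 \<le> weight D" using weight_forced2[OF D_active x(1) g(1)] g obx obg by simp
        have "\<not> A \<subseteq> {x, g}" using D_third_var[of x g] D_A by blast
        then obtain h where h: "h \<in> A" "h \<notin> {x, g}" "nvars (parent h) \<subseteq> {x, g}" by (rule forced_minimal[OF D_active])
        have ht: "h \<in> T c" using h A_T by blast
        have nph: "\<not> root_var h" using only h by auto
        then have "card (nvars (parent h)) = 2" using card_nvars_parent[OF ht nph] nop2 h by auto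
        then have nh: "nvars (parent h) = {x, g}" using h g by (intro card_seteq) auto
        have "nvars (parent h) \<subseteq> forced (parent h)" using T_dest(5)[OF c ht] by (rule forced_nvars)
        then have wh: "6 \<le> weight (parent h)" using weight_forced2[OF parent_active[OF ht], of x g] nh g obx obg by simp
        show ?thesis
        proof (cases "A \<subseteq> {x, g, h}")
          case True
          then have nD: "nvars D = {x, g, h}" using D_A D_eq by (metis subset_trans)
          \<comment> \<open>The derivation is itself the cheap pattern, so \<open>x\<close> has a
            dead alternative \<open>a\<close>. It is not \<open>g\<close>, which is true, and its
            clauses \<open>E\<close> and \<open>E'\<close> push the negation of \<open>x\<close>
            beyond four occurrences.\<close>
          have "bad_seq x g" unfolding bad_seq_def
            using x g nh nD D T_dest(1,2)[OF c gt] T_dest(1,2)[OF c ht] by blast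
          then obtain a where a: "a \<in> Dead" "bad_seq x a" using bad_dead bad_eq by blast
          obtain E E' where E: "E \<in> active c" "E' \<in> active c" "E \<noteq> E'" "3 \<le> weight E" "3 \<le> weight E'" "E \<noteq> D" "E' \<noteq> D"
            "\<forall>h\<in>T c. parent h \<noteq> E \<and> E \<noteq> parent h" "\<forall>h\<in>T c. parent h \<noteq> E' \<and> E' \<noteq> parent h"
            "x \<in> nvars E" "x \<in> nvars E'" "a \<in> nvars E" "a \<in> nvars E'" "E \<in> F" "E' \<in> F"
            by (rule bad_seq_clauses[OF a(2,1) xt])
          have "length [parent g, E, E', parent h, D] \<le> q"
          proof (rule nvars_occ)
            show "distinct [parent g, E, E', parent h, D]" using E gt ht h parent_inj parent_D by auto
            show "set [parent g, E, E', parent h, D] \<subseteq> F" using E D T_dest(1)[OF c] gt ht by auto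
          qed (use E nD nh g in auto)
          then show ?thesis using q by simp
        next
          case False
          then obtain k where k: "k \<in> A" "k \<notin> {x, g, h}" by blast
          have kt: "k \<in> T c" using k A_T by blast
          have "\<not> root_var k" using only k by auto
          then have "3 \<le> weight (parent k)" using weight_parent kt by blast
          \<comment> \<open>The sum is 1 + 3 + 6 + 3 + 6 = 19.\<close>
          moreover have "distinct [parent x, parent g, parent h, parent k, D]"
            using xt gt ht kt h k g parent_inj parent_D by auto
          ultimately show ?thesis using load_list[of "[parent x, parent g, parent h, parent k, D]"]
            D_active parent_active xt gt ht kt w' wh wD by simp
        qed
      qed
    qed
  qed
qed

section \<open>The load for \<open>q <= 3\<close>\<close>

text \<open>A common interface to both patterns. For \<open>q <= 3\<close> the clauses
  \<open>parent a\<close>, \<open>X1\<close> and \<open>X2\<close> exhaust the negative occurrences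
  of \<open>x\<close>. \<open>X1\<close> can be the parent of a true variable only in the parallel
  pattern.\<close>

lemma bad_clauses:
  assumes "a \<in> Dead" "bad_seq x a \<or> bad_par x a" "x \<in> T c"
  obtains X1 X2 where "X1 \<in> active c" "X2 \<in> active c" "3 \<le> weight X1" "3 \<le> weight X2" "distinct [X1, X2, parent a, D]"
    "\<forall>h\<in>T c. parent h \<noteq> X2 \<and> X2 \<noteq> parent h" "x \<in> nvars X1" "x \<in> nvars X2" "X1 \<in> F" "X2 \<in> F"
    "\<forall>h\<in>T c. parent h = X1 \<longrightarrow> nvars X1 = {x}" "a \<in> nvars X2"
proof (cases "bad_seq x a")
  case True
  obtain E E' where E: "E \<in> active c" "E' \<in> active c" "E \<noteq> E'" "3 \<le> weight E" "3 \<le> weight E'" "E \<noteq> D" "E' \<noteq> D"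
    "\<forall>h\<in>T c. parent h \<noteq> E \<and> E \<noteq> parent h" "\<forall>h\<in>T c. parent h \<noteq> E' \<and> E' \<noteq> parent h"
    "x \<in> nvars E" "x \<in> nvars E'" "a \<in> nvars E" "a \<in> nvars E'" "E \<in> F" "E' \<in> F"
    by (rule bad_seq_clauses[OF True assms(1,3)])
  have "a \<notin> nvars (parent a)" "parent a \<noteq> D" using vars_disjoint dead_dest[OF assms(1)] D by (metis, metis empty_iff)
  then show ?thesis using that[of E E'] E by auto
next
  case False
  then have b: "bad_par x a" using assms by blast
  obtain C' E where E: "C' \<in> F" "E \<in> F" "C' \<noteq> parent a" "nvars C' = {x}" "C' \<in> active c" "3 \<le> weight C'"
    "E \<in> active c" "3 \<le> weight E" "E \<noteq> D" "\<forall>h\<in>T c. parent h \<noteq> E \<and> E \<noteq> parent h" "x \<in> nvars E" "a \<in> nvars E" "C' \<noteq> E"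
    by (rule bad_par_clauses[OF b assms(1,3)])
  have "a \<notin> nvars (parent a)" "parent a \<noteq> D" using vars_disjoint dead_dest[OF assms(1)] D by (metis, metis empty_iff)
  moreover have "C' \<noteq> D" using E(4) card_D by auto
  ultimately show ?thesis using that[of C' E] E by auto
qed

text \<open>The derivation of the premises stays inside \<open>A\<close>, so it starts at
  \<open>x\<close> and continues with a rule from \<open>x\<close> alone, which has two live
  options: 3 * 2.\<close>

lemma weight_six:
  assumes "x \<in> A" "root_var x" "\<And>y. y \<in> A \<Longrightarrow> root_var y \<Longrightarrow> y = x" "\<And>h. h \<in> A \<Longrightarrow> pvars (parent h) \<inter> Dead = {}"
    "h \<in> A" "\<not> nvars (parent h) \<subseteq> {x}"
  shows "6 \<le> weight (parent h)"
proof -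
  have ht: "h \<in> T c" using assms A_T by blast
  have n: "nvars (parent h) \<subseteq> T c" using T_dest(5)[OF c ht] .
  have sub: "forced (parent h) \<subseteq> A" using forced_trans[OF n] forced_closed assms(5) by blast
  have "\<not> forced (parent h) \<subseteq> {x}" using forced_nvars[OF n] assms(6) by blast
  then obtain g where g: "g \<in> forced (parent h)" "g \<notin> {x}" "nvars (parent g) \<subseteq> {x}"
    by (rule forced_minimal[OF parent_active[OF ht]])
  have gt: "g \<in> T c" using g sub A_T by blast
  have "\<not> root_var g" using assms(3) g sub by blast
  then have ng: "nvars (parent g) = {x}" using T_dest(7)[OF c gt] g by blast
  then have "x \<in> forced (parent h)" using forced_closed[OF g(1)] by blast
  moreover have "branching g = 2" using branching_p2[OF gt] ng assms(4) g sub by auto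
  moreover have "branching x = 3" using branching_root_var assms A_T by blast
  ultimately show ?thesis using weight_forced2[OF parent_active[OF ht], of x g] g by simp
qed

lemma two_roots_dead_p2:
  assumes q: "q \<le> 3" and bad_iff: "\<And>x a. bad x a \<longleftrightarrow> bad_seq x a \<or> bad_par x a"
    and x: "x \<in> A" "root_var x" and y: "y \<in> A" "root_var y" "y \<noteq> x"
    and only: "\<And>z. z \<in> A \<Longrightarrow> root_var z \<Longrightarrow> z = x \<or> z = y"
    and dead: "\<And>g. g \<in> A \<Longrightarrow> card (nvars (parent g)) = 1 \<Longrightarrow> pvars (parent g) \<inter> Dead \<noteq> {}"
    and g: "g \<in> A" "nvars (parent g) = {x}"
  shows "22 \<le> load c"
proof -
  have xt: "x \<in> T c" and yt: "y \<in> T c" and gt: "g \<in> T c" using x y g A_T by auto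
  have branching: "branching x = 3" "branching y = 3" using xt x yt y branching_root_var by auto
  have dg: "pvars (parent g) \<inter> Dead \<noteq> {}" using dead g by simp
  obtain x' a where a': "a \<in> Dead" "bad x' a" "parent a = parent g" "nvars (parent g) = {x'}" "root_var x'" "x' \<in> T c"
    by (rule dead_sibling[OF gt dg])
  then have bxa: "bad_seq x a \<or> bad_par x a" using g bad_iff by auto
  obtain X1 X2 where X: "X1 \<in> active c" "X2 \<in> active c" "3 \<le> weight X1" "3 \<le> weight X2" "distinct [X1, X2, parent a, D]"
    "\<forall>h\<in>T c. parent h \<noteq> X2 \<and> X2 \<noteq> parent h" "x \<in> nvars X1" "x \<in> nvars X2" "X1 \<in> F" "X2 \<in> F"
    "\<forall>h\<in>T c. parent h = X1 \<longrightarrow> nvars X1 = {x}" "a \<in> nvars X2"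
    by (rule bad_clauses[OF a'(1) bxa xt])
  \<comment> \<open>\<open>X1\<close>, \<open>X2\<close> and \<open>parent g\<close> already use all
    three occurrences, so \<open>D\<close> has a variable outside \<open>x\<close>, \<open>y\<close>
    and \<open>g\<close>.\<close>
  have xD: "x \<notin> nvars D"
  proof
    assume "x \<in> nvars D"
    moreover have "distinct [X1, X2, parent g, D]" using X(5) a'(3) by simp
    ultimately have "length [X1, X2, parent g, D] \<le> q"
      using X(7-10) D(1) T_dest(1)[OF c gt] g(2) by (intro nvars_occ[of _ x]) auto
    then show False using q by simp
  qed
  obtain h where h: "h \<in> nvars D" "h \<noteq> g" "h \<noteq> y" using D_third_var by blast
  have hA: "h \<in> A" and ht: "h \<in> T c" and hx: "h \<noteq> x" using h D_A A_T xD by auto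
  have nph: "\<not> root_var h" using only hA hx h by blast
  have npg: "\<not> root_var g" using T_dest(7)[OF c gt] g by simp
  \<comment> \<open>Otherwise \<open>X1\<close> would be a second one-premise rule from
    \<open>x\<close> with a dead alternative, but only one alternative per root is dead.\<close>
  have X1: "parent k \<noteq> X1" if k: "k \<in> A" "k \<noteq> g" for k
  proof
    assume e: "parent k = X1"
    have kt: "k \<in> T c" using k A_T by blast
    then have "nvars (parent k) = {x}" using X e by blast
    then show False using dead[of k] k dead_p2_unique[OF gt kt dg] g by simp
  qed
  have xyg: "x \<noteq> g" "y \<noteq> g" using x y npg by auto
  have nX1: "parent x \<noteq> X1" "parent y \<noteq> X1" "parent h \<noteq> X1" "X1 \<noteq> parent g" "X1 \<noteq> X2" "X1 \<noteq> D" "X2 \<noteq> D"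
    using X1[OF x(1)] X1[OF y(1)] X1[OF hA h(2)] xyg X(5) a'(3) by simp_all
  \<comment> \<open>The sum is 1 + 3 + 3 + 3 + 1 + 9 + 3 = 23.\<close>
  have "distinct [parent x, parent g, X1, X2, parent y, D, parent h]"
    using nX1 X(6) h(2,3) y(3) hx xyg xt yt gt ht parent_D by (auto simp: parent_inj)
  moreover have "1 \<le> weight (parent x)" "1 \<le> weight (parent y)" "3 \<le> weight (parent g)" "3 \<le> weight (parent h)"
    using weight_ge_1 weight_parent parent_active xt yt gt ht nph npg by auto
  moreover have "9 \<le> weight D" using weight_forced2[OF D_active x(1) y(1)] y branching by simp
  ultimately show ?thesis using load_list[of "[parent x, parent g, X1, X2, parent y, D, parent h]"] X
    D_active parent_active xt yt gt ht by simp
qed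

text \<open>The occurrences of the negation of \<open>x\<close> are exhausted by
  \<open>parent g\<close>, \<open>X1\<close> and \<open>X2\<close>, so \<open>D\<close> and all
  other rules avoid \<open>x\<close> and the derivation must be longer. The split is on whether
  \<open>X1\<close> concludes a variable of \<open>A\<close>; each case sums to exactly 22.\<close>

lemma one_root_dead_p2:
  assumes q: "q \<le> 3" and bad_iff: "\<And>x a. bad x a \<longleftrightarrow> bad_seq x a \<or> bad_par x a"
    and x: "x \<in> A" "root_var x" and only: "\<And>z. z \<in> A \<Longrightarrow> root_var z \<Longrightarrow> z = x"
    and g: "g \<in> A" and dg: "pvars (parent g) \<inter> Dead \<noteq> {}"
  shows "22 \<le> load c"
proof -
  have xt: "x \<in> T c" and gt: "g \<in> T c" using x g A_T by auto
  have obx: "branching x = 3" using xt x branching_root_var by auto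
  have dead_x: "nvars (parent h) = {x}" if h: "h \<in> A" "pvars (parent h) \<inter> Dead \<noteq> {}" for h
  proof -
    have ht: "h \<in> T c" using h A_T by blast
    obtain x' a where a: "a \<in> Dead" "bad x' a" "parent a = parent h" "nvars (parent h) = {x'}" "root_var x'" "x' \<in> T c"
      by (rule dead_sibling[OF ht h(2)])
    then have "x' = x" using only forced_closed[OF h(1)] by auto
    then show ?thesis using a by simp
  qed
  have dead_g: "h = g" if h: "h \<in> A" "pvars (parent h) \<inter> Dead \<noteq> {}" for h
    using dead_p2_unique[of h g] h g dg dead_x A_T by blast
  have ng: "nvars (parent g) = {x}" using dead_x g dg by blast
  obtain x' a where a': "a \<in> Dead" "bad x' a" "parent a = parent g" "nvars (parent g) = {x'}" "root_var x'" "x' \<in> T c"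
    by (rule dead_sibling[OF gt dg])
  then have bxa: "bad_seq x a \<or> bad_par x a" using ng bad_iff by auto
  obtain X1 X2 where X: "X1 \<in> active c" "X2 \<in> active c" "3 \<le> weight X1" "3 \<le> weight X2" "distinct [X1, X2, parent a, D]"
    "\<forall>h\<in>T c. parent h \<noteq> X2 \<and> X2 \<noteq> parent h" "x \<in> nvars X1" "x \<in> nvars X2" "X1 \<in> F" "X2 \<in> F"
    "\<forall>h\<in>T c. parent h = X1 \<longrightarrow> nvars X1 = {x}" "a \<in> nvars X2"
    by (rule bad_clauses[OF a'(1) bxa xt])
  have Xd: "distinct [X1, X2, parent g, D]" using X(5) a'(3) by simp
  have ex: "C = parent g \<or> C = X1 \<or> C = X2" if "C \<in> F" "x \<in> nvars C" for C
  proof (rule ccontr)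
    assume "\<not> ?thesis"
    then have "length [X1, X2, parent g, C] \<le> q"
      using X(7-10) Xd that T_dest(1)[OF c gt] ng by (intro nvars_occ[of _ x]) auto
    then show False using q by simp
  qed
  have xD: "x \<notin> nvars D" using ex[OF D(1)] Xd by auto
  have npg: "\<not> root_var g" using T_dest(7)[OF c gt] ng by simp
  have xg: "x \<noteq> g" using x npg by auto
  have X1x: "parent x \<noteq> X1" using X(7) T_dest(7)[OF c xt] x by auto
  have wx: "1 \<le> weight (parent x)" "3 \<le> weight (parent g)" using weight_ge_1 weight_parent parent_active xt gt npg by auto
  have base: "distinct [parent x, parent g, X1, X2, D]"
    using Xd X(6) xt gt xg X1x parent_D by (auto simp: parent_inj)
  show ?thesis
  proof (cases "\<exists>e\<in>A. parent e = X1")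
    case True
    then obtain e where e: "e \<in> A" "parent e = X1" by blast
    have et: "e \<in> T c" using e A_T by blast
    have ne: "nvars (parent e) = {x}" using X(11) et e by blast
    have eg: "e \<noteq> g" using e(2) Xd by auto
    have ex': "e \<noteq> x" using e X1x by auto
    have obe: "branching e = 2" using branching_p2[OF et] ne dead_g e eg by auto
    obtain h0 where "h0 \<in> nvars D" "h0 \<noteq> g" "h0 \<noteq> e" using D_third_var by blast
    then have "\<not> A \<subseteq> {x, g, e}" using D_A xD by auto
    then obtain h where h: "h \<in> A" "h \<notin> {x, g, e}" "nvars (parent h) \<subseteq> {x, g, e}"
      by (rule forced_minimal[OF D_active])
    have ht: "h \<in> T c" using h A_T by blast
    have hX1: "parent h \<noteq> X1" using e h parent_inj et ht by auto
    have "x \<notin> nvars (parent h)"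
      using ex[OF T_dest(1)[OF c ht]] hX1 X(6) ht h parent_inj gt by auto
    then have nh: "nvars (parent h) \<subseteq> {g, e}" using h by blast
    have nph: "\<not> root_var h" using only h by auto
    have dist: "distinct [parent x, parent g, X1, X2, D, parent h]"
      using base h(2) hX1 X(6) ht xt gt parent_D[OF ht] by (auto simp: parent_inj)
    have w6: "6 \<le> weight D" using weight_forced2[OF D_active x(1) e(1)] ex' obx obe by simp
    show ?thesis
    proof (cases "card (nvars (parent h)) = 1")
      case True
      have "branching h = 2" using branching_p2[OF ht True] dead_g h by auto
      \<comment> \<open>Total 1 + 3 + 3 + 3 + 12 = 22; in the other case \<open>D\<close> and
        \<open>parent h\<close> weigh 6 each, with the same total.\<close>
      then have "12 \<le> weight D" using weight_forced3[OF D_active x(1) e(1) h(1)] ex' h obx obe by auto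
      then show ?thesis using load_list[of "[parent x, parent g, X1, X2, D]"] base X D_active parent_active xt gt wx by simp
    next
      case False
      then have "card (nvars (parent h)) = 2" using card_nvars_parent[OF ht nph] by simp
      then have "nvars (parent h) = {g, e}" using nh eg by (intro card_seteq) auto
      then have "e \<in> forced (parent h)" using forced_nvars[OF T_dest(5)[OF c ht]] by auto
      moreover then have "x \<in> forced (parent h)" using forced_closed ne by blast
      ultimately have "6 \<le> weight (parent h)" using weight_forced2[OF parent_active[OF ht], of x e] ex' obx obe by simp
      then show ?thesis using load_list[of "[parent x, parent g, X1, X2, D, parent h]"] dist w6 X D_active parent_active xt gt ht wx
        by simp
    qed
  next
    case False
    have "\<not> A \<subseteq> {x, g}" using D_third_var[of x g] D_A by blast
    then obtain h where h: "h \<in> A" "h \<notin> {x, g}" "nvars (parent h) \<subseteq> {x, g}" by (rule forced_minimal[OF D_active])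
    have ht: "h \<in> T c" using h A_T by blast
    have nph: "\<not> root_var h" using only h by auto
    have "x \<notin> nvars (parent h)"
      using ex[OF T_dest(1)[OF c ht]] False X(6) ht h parent_inj gt by auto
    moreover have "nvars (parent h) \<noteq> {}" using nph T_dest(7)[OF c ht] by simp
    ultimately have nh: "nvars (parent h) = {g}" using h by blast
    have obh: "branching h = 2" using branching_p2[OF ht] nh dead_g h by auto
    obtain k where k: "k \<in> nvars D" "k \<noteq> g" "k \<noteq> h" using D_third_var by blast
    have kA: "k \<in> A" and kt: "k \<in> T c" and kx: "k \<noteq> x" using k D_A A_T xD by auto
    have npk: "\<not> root_var k" using only kA kx by auto
    have "parent h \<noteq> X1" "parent k \<noteq> X1" using False h kA by auto
    \<comment> \<open>The sum is 1 + 3 + 3 + 3 + 6 + 3 + 3 = 22.\<close>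
    then have "distinct [parent x, parent g, X1, X2, D, parent h, parent k]"
      using base h(2) k(2,3) kx X(6) ht kt xt gt parent_D[OF ht] parent_D[OF kt] by (auto simp: parent_inj)
    moreover have "3 \<le> weight (parent h)" "3 \<le> weight (parent k)" using weight_parent ht kt nph npk by auto
    moreover have "6 \<le> weight D" using weight_forced2[OF D_active x(1) h(1)] h obx obh by auto
    ultimately show ?thesis using load_list[of "[parent x, parent g, X1, X2, D, parent h, parent k]"]
      X D_active parent_active xt gt ht kt wx by simp
  qed
qed

text \<open>A derivation light enough to miss 22 is one of the two bad patterns at \<open>x\<close>;
  then \<open>x\<close> has a dead alternative elsewhere, whose clauses leave too few occurrences of
  \<open>x\<close> for this derivation.\<close>

lemma one_root_no_dead:
  assumes q: "q \<le> 3" and bad_iff: "\<And>x a. bad x a \<longleftrightarrow> bad_seq x a \<or> bad_par x a"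
    and x: "x \<in> A" "root_var x" and only: "\<And>z. z \<in> A \<Longrightarrow> root_var z \<Longrightarrow> z = x"
    and nodead: "\<And>h. h \<in> A \<Longrightarrow> pvars (parent h) \<inter> Dead = {}"
  shows "22 \<le> load c"
proof -
  have xt: "x \<in> T c" using x A_T by auto
  have obx: "branching x = 3" using xt x branching_root_var by auto
  obtain g where g: "g \<in> A" "g \<noteq> x" "nvars (parent g) = {x}" by (rule one_root_start[OF only x])
  have gt: "g \<in> T c" using g A_T by blast
  have npg: "\<not> root_var g" using only g by blast
  have obg: "branching g = 2" using branching_p2[OF gt] g nodead by simp
  have w': "1 \<le> weight (parent x)" "3 \<le> weight (parent g)" using weight_ge_1 parent_active xt weight_parent gt npg by auto
  have six: "6 \<le> weight (parent h)" if "h \<in> A" "\<not> nvars (parent h) \<subseteq> {x}" for h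
    using weight_six[OF x only nodead that] .
  \<comment> \<open>\<open>X2\<close> contains a dead variable, so it is a fourth clause besides
    \<open>parent g\<close>, \<open>parent h\<close> and \<open>D\<close>.\<close>
  have exhausted: False if "bad_seq x g \<or> bad_par x g" "x \<in> nvars D" "h \<in> A" "h \<noteq> g" "x \<in> nvars (parent h)" for h
  proof -
    have ht: "h \<in> T c" using that A_T by blast
    obtain a where a: "a \<in> Dead" "bad_seq x a \<or> bad_par x a" using bad_dead[of x g] bad_iff \<open>bad_seq x g \<or> bad_par x g\<close> by blast
    obtain X1 X2 where X: "X1 \<in> active c" "X2 \<in> active c" "3 \<le> weight X1" "3 \<le> weight X2" "distinct [X1, X2, parent a, D]"
      "\<forall>h\<in>T c. parent h \<noteq> X2 \<and> X2 \<noteq> parent h" "x \<in> nvars X1" "x \<in> nvars X2" "X1 \<in> F" "X2 \<in> F"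
      "\<forall>h\<in>T c. parent h = X1 \<longrightarrow> nvars X1 = {x}" "a \<in> nvars X2"
      by (rule bad_clauses[OF a xt])
    have "distinct [parent g, parent h, D, X2]"
      using X(5,6) that(4) gt ht parent_D by (auto simp: parent_inj)
    then have "length [parent g, parent h, D, X2] \<le> q"
      using X(8,10) D(1) T_dest(1)[OF c gt] T_dest(1)[OF c ht] g(3) that(2,5) by (intro nvars_occ[of _ x]) auto
    then show False using q by simp
  qed
  have wD: "6 \<le> weight D" using weight_forced2[OF D_active x(1) g(1)] g obx obg by simp
  show ?thesis
  proof (cases "\<exists>h\<in>A. card (nvars (parent h)) = 1 \<and> h \<noteq> g")
    case True
    then obtain h where h: "h \<in> A" "card (nvars (parent h)) = 1" "h \<noteq> g" by blast
    have ht: "h \<in> T c" using h A_T by blast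
    have nph: "\<not> root_var h" using T_dest(7)[OF c ht] h by auto
    have hx: "h \<noteq> x" using nph x by auto
    have obh: "branching h = 2" using branching_p2[OF ht h(2)] nodead h by auto
    have w12: "12 \<le> weight D" using weight_forced3[OF D_active x(1) g(1) h(1)] obx obg obh h g hx by auto
    have wh: "3 \<le> weight (parent h)" using weight_parent ht nph by blast
    have dist: "distinct [parent x, parent g, parent h, D]" using xt gt ht h g hx parent_D by (auto simp: parent_inj)
    show ?thesis
    proof (cases "nvars (parent h) = {x}")
      case False
      then have "\<not> nvars (parent h) \<subseteq> {x}" using h(2) by (auto simp: subset_singleton_iff)
      then show ?thesis using six[OF h(1)] load_list[of "[parent x, parent g, parent h, D]"] dist
        D_active parent_active xt gt ht w' w12 by simp
    next
      case nh: True
      show ?thesis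
      proof (cases "A \<subseteq> {x, g, h}")
        case True
        then have nD: "nvars D = {x, g, h}" using D_A D_eq by (metis subset_trans)
        have "parent g \<noteq> parent h" using parent_inj gt ht h by auto
        then have "bad_par x g" unfolding bad_par_def
          using x g nh nD D T_dest(1,2)[OF c gt] T_dest(1,2)[OF c ht] by blast
        then show ?thesis using exhausted[of h] nD nh h by auto
      next
        case False
        then obtain k where k: "k \<in> A" "k \<notin> {x, g, h}" by blast
        have kt: "k \<in> T c" using k A_T by blast
        have "\<not> root_var k" using only k by auto
        then have "3 \<le> weight (parent k)" using weight_parent kt by blast
        \<comment> \<open>The sum is 1 + 3 + 3 + 12 + 3 = 22.\<close>
        moreover have "distinct [parent x, parent g, parent h, D, parent k]"
          using dist k xt gt ht kt parent_D by (auto simp: parent_inj)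
        ultimately show ?thesis using load_list[of "[parent x, parent g, parent h, D, parent k]"]
          D_active parent_active xt gt ht kt w' w12 wh by simp
      qed
    qed
  next
    case nop2: False
    have "\<not> A \<subseteq> {x, g}" using D_third_var[of x g] D_A by blast
    then obtain h where h: "h \<in> A" "h \<notin> {x, g}" "nvars (parent h) \<subseteq> {x, g}" by (rule forced_minimal[OF D_active])
    have ht: "h \<in> T c" using h A_T by blast
    have two: "card (nvars (parent k)) = 2" if "k \<in> A" "k \<noteq> x" "k \<noteq> g" for k
      using card_nvars_parent[of k] only[of k] nop2 that A_T by auto
    have nh: "nvars (parent h) = {x, g}" using h g two[of h] by (intro card_seteq) auto
    have wh: "6 \<le> weight (parent h)" using six[OF h(1)] nh g by auto
    show ?thesis
    proof (cases "A \<subseteq> {x, g, h}")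
      case True
      then have nD: "nvars D = {x, g, h}" using D_A D_eq by (metis subset_trans)
      have "bad_seq x g" unfolding bad_seq_def
        using x g nh nD D T_dest(1,2)[OF c gt] T_dest(1,2)[OF c ht] by blast
      then show ?thesis using exhausted[of h] nD nh h by auto
    next
      case False
      then obtain k where k: "k \<in> A" "k \<notin> {x, g, h}" by blast
      have kt: "k \<in> T c" using k A_T by blast
      have "\<not> nvars (parent k) \<subseteq> {x}"
      proof
        assume "nvars (parent k) \<subseteq> {x}"
        then have "card (nvars (parent k)) \<le> card {x}" by (intro card_mono) auto
        then show False using two[of k] k by simp
      qed
      then have "6 \<le> weight (parent k)" using six k by blast
      \<comment> \<open>The sum is 1 + 3 + 6 + 6 + 6 = 22.\<close>
      moreover have "distinct [parent x, parent g, parent h, D, parent k]"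
        using h k g xt gt ht kt parent_D by (auto simp: parent_inj)
      ultimately show ?thesis using load_list[of "[parent x, parent g, parent h, D, parent k]"]
        D_active parent_active xt gt ht kt w' wh wD by simp
    qed
  qed
qed

text \<open>The exceptional disjunct keeps the number of all-positive clauses, because the possible
  deficit is averaged out in terms of that number.\<close>

lemma load_ge_22:
  assumes q: "q \<le> 3" and bad_iff: "\<And>x a. bad x a \<longleftrightarrow> bad_seq x a \<or> bad_par x a"
  shows "22 \<le> load c \<or> (\<exists>x y. x \<in> T c \<and> y \<in> T c \<and> Cpair x y \<and> 18 + card {C \<in> F. nvars C = {}} \<le> load c)"
proof -
  obtain x where x: "x \<in> A" "root_var x" by (rule exists_root_var)
  show ?thesis
  proof (cases "\<exists>y\<in>A. root_var y \<and> y \<noteq> x")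
    case True
    then obtain y where y: "y \<in> A" "root_var y" "y \<noteq> x" by blast
    show ?thesis
    proof (cases "\<exists>z\<in>A. root_var z \<and> z \<noteq> x \<and> z \<noteq> y")
      case True
      then show ?thesis using three_roots[OF x(1) y(1) _ x(2) y(2)] y by force
    next
      case False
      then have only: "\<And>z. z \<in> A \<Longrightarrow> root_var z \<Longrightarrow> z = x \<or> z = y" by blast
      show ?thesis
      proof (cases "\<exists>g\<in>A. card (nvars (parent g)) = 1")
        case False
        then have no: "\<And>g. g \<in> A \<Longrightarrow> card (nvars (parent g)) \<noteq> 1" by blast
        show ?thesis
          using two_roots_no_p2[OF x(1) y(1) x(2) y(2) y(3)[symmetric] only no] x y A_T by blast
      next
        case True
        then obtain g where g: "g \<in> A" "card (nvars (parent g)) = 1" by blast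
        show ?thesis
        proof (cases "\<exists>g\<in>A. card (nvars (parent g)) = 1 \<and> pvars (parent g) \<inter> Dead = {}")
          case True
          then obtain h where "h \<in> A" "card (nvars (parent h)) = 1" "pvars (parent h) \<inter> Dead = {}" by blast
          then show ?thesis using two_roots_free_p2[OF x(1) y(1) x(2) y(2) y(3)[symmetric], of h] by simp
        next
          case False
          then have dead: "\<And>g. g \<in> A \<Longrightarrow> card (nvars (parent g)) = 1 \<Longrightarrow> pvars (parent g) \<inter> Dead \<noteq> {}" by blast
          have gt: "g \<in> T c" using g A_T by blast
          obtain x' a where a': "a \<in> Dead" "bad x' a" "parent a = parent g" "nvars (parent g) = {x'}" "root_var x'" "x' \<in> T c"
            by (rule dead_sibling[OF gt dead[OF g]])
          have "x' \<in> A" using forced_closed[OF g(1)] a' by auto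
          then consider "x' = x" | "x' = y" using only a' by blast
          then show ?thesis
          proof cases
            case 1
            then have "nvars (parent g) = {x}" using a' by simp
            then show ?thesis using two_roots_dead_p2[OF q bad_iff x y only dead g(1)] by simp
          next
            case 2
            have only': "\<And>z. z \<in> A \<Longrightarrow> root_var z \<Longrightarrow> z = y \<or> z = x" using only by blast
            have "nvars (parent g) = {y}" using a' 2 by simp
            then show ?thesis using two_roots_dead_p2[OF q bad_iff y(1,2) x y(3)[symmetric] only' dead g(1)] by simp
          qed
        qed
      qed
    qed
  next
    case False
    then have only: "\<And>z. z \<in> A \<Longrightarrow> root_var z \<Longrightarrow> z = x" by blast
    show ?thesis
    proof (cases "\<exists>g\<in>A. pvars (parent g) \<inter> Dead \<noteq> {}")
      case True
      then show ?thesis using one_root_dead_p2[OF q bad_iff x only] by blast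
    next
      case False
      then have "\<And>g. g \<in> A \<Longrightarrow> pvars (parent g) \<inter> Dead = {}" by blast
      then show ?thesis using one_root_no_dead[OF q bad_iff x only] by blast
    qed
  qed
qed



end

section \<open>Rarity of the exceptional pairs and the final averages\<close>

context unsat_formula
begin

lemma Cpair_sym: "Cpair x y \<Longrightarrow> Cpair y x"
  unfolding Cpair_def by (metis insert_commute)

text \<open>Each partner of \<open>x\<close> accounts for two clauses containing the negation of
  \<open>x\<close>, so two partners would need four.\<close>

lemma Cpair_partner:
  assumes q: "q \<le> 3" and p: "Cpair x y" "Cpair x y'"
  shows "y = y'"
proof (rule ccontr)
  assume ne: "y \<noteq> y'"
  obtain z E E' where E: "E \<in> F" "E' \<in> F" "nvars E = {x, y}" "z \<in> pvars E" "pvars E' = {}" "nvars E' = {x, y, z}"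
    and y: "x \<noteq> y" "root_var y" using p(1) unfolding Cpair_def by blast
  obtain z' G G' where G: "G \<in> F" "G' \<in> F" "nvars G = {x, y'}" "z' \<in> pvars G" "pvars G' = {}" "nvars G' = {x, y', z'}"
    and y': "x \<noteq> y'" using p(2) unfolding Cpair_def by blast
  \<comment> \<open>A conclusion of a rule with premises is not a root; hence \<open>y\<close> does
    not occur in \<open>G'\<close>, which separates \<open>E'\<close> from
    \<open>G'\<close>.\<close>
  have "z' \<noteq> y" using root_var_iff[OF G(1,4)] G(3) y(2) by auto
  then have "nvars E' \<noteq> nvars G'" "nvars E \<noteq> nvars G" using E(3,6) G(3,6) ne y y' by auto
  then have "distinct [E, E', G, G']" using E(4,5) G(4,5) by auto
  then have "length [E, E', G, G'] \<le> q" using E(1,2,3,6) G(1,2,3,6) by (intro nvars_occ[of _ x]) auto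
  then show False using q by simp
qed

text \<open>By uniqueness of partners a pair is determined by its first component, a root, and each
  all-positive clause supplies three roots.\<close>

lemma card_Cpair:
  assumes "q \<le> 3"
  shows "finite {(x, y). Cpair x y}" "card {(x, y). Cpair x y} \<le> 3 * card {C \<in> F. nvars C = {}}"
proof -
  let ?N = "{C \<in> F. nvars C = {}}" and ?Z = "{(x, y). Cpair x y}"
  let ?P = "\<Union>C\<in>?N. pvars C"
  have "card (pvars C) = 3" if "C \<in> ?N" for C using card_vars[of C] that by simp
  then have "card ?P \<le> 3 * card ?N" using card_UN_le[of ?N pvars] finite_F by simp
  moreover have "finite ?P" using finite_F finite_vars by auto
  moreover have "inj_on fst ?Z" using Cpair_partner[OF assms] by (auto simp: inj_on_def)
  moreover have "fst ` ?Z \<subseteq> ?P" by (auto simp: Cpair_def root_var_def)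
  ultimately show "finite ?Z" "card ?Z \<le> 3 * card ?N"
    by (meson inj_on_finite, meson card_inj_on_le le_trans)
qed

lemma card_F_ge_19:
  assumes "q \<le> 4"
  shows "19 \<le> card F"
proof -
  interpret pruned_formula F q bad_seq
    by unfold_locales (auto simp: bad_seq_def)
  have "19 \<le> load c" if c: "c \<in> choices" for c
  proof -
    obtain D where "D \<in> F" "pvars D = {}" "nvars D \<subseteq> T c" using ex_violated_clause[OF c] by blast
    then interpret violated_clause F q bad_seq c D by unfold_locales (use c in auto)
    show ?thesis using load_ge_19 assms by simp
  qed
  then show ?thesis using card_F_ge[of 19] by simp
qed

lemma card_F_ge_22:
  assumes q: "q \<le> 3"
  shows "22 \<le> card F"
proof -
  interpret pruned_formula F q "\<lambda>x a. bad_seq x a \<or> bad_par x a"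
    by unfold_locales (auto simp: bad_seq_def bad_par_def)
  define n where "n = card {C \<in> F. nvars C = {}}"
  define Z where "Z = {(x, y). Cpair x y}"
  define \<delta> where "\<delta> = max 0 ((4 - real n) / 2)"
  \<comment> \<open>A root has at most one partner, so the average number of ordered pairs chosen is at most \<open>n / 3\<close>,
    and each chosen pair lacks at most \<open>\<delta>\<close>; the total loss is at most \<open>(4 - n) n / 6 < 1\<close>.\<close>
  define N where "N c = {p \<in> Z. {fst p, snd p} \<subseteq> T c}" for c
  have Z: "finite Z" "card Z \<le> 3 * n" using card_Cpair[OF q] by (auto simp: Z_def n_def)
  have low: "22 \<le> load c + \<delta> * card (N c)" if c: "c \<in> choices" for c
  proof -
    obtain D where "D \<in> F" "pvars D = {}" "nvars D \<subseteq> T c" using ex_violated_clause[OF c] by blast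
    then interpret violated_clause F q "\<lambda>x a. bad_seq x a \<or> bad_par x a" c D by unfold_locales (use c in auto)
    have "22 \<le> load c \<or> (\<exists>x y. x \<in> T c \<and> y \<in> T c \<and> Cpair x y \<and> 18 + n \<le> load c)"
      using load_ge_22[OF q] by (simp add: n_def)
    then consider "22 \<le> load c" | x y where "x \<in> T c" "y \<in> T c" "Cpair x y" "18 + n \<le> load c" by blast
    then show ?thesis
    proof cases
      case 1
      then show ?thesis by (simp add: \<delta>_def add_increasing2)
    next
      case 2
      \<comment> \<open>Pairs are ordered, so an exceptional choice is counted at least twice; this
        explains the division by 2 in \<open>\<delta>\<close>.\<close>
      then have "{(x, y), (y, x)} \<subseteq> N c" using Cpair_sym by (auto simp: N_def Z_def)
      moreover have "finite (N c)" using Z by (simp add: N_def)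
      ultimately have "card {(x, y), (y, x)} \<le> card (N c)" by (rule card_mono[rotated])
      moreover have "x \<noteq> y" using 2 by (simp add: Cpair_def)
      ultimately have "2 \<le> card (N c)" by simp
      then have "\<delta> * 2 \<le> \<delta> * card (N c)" by (intro mult_left_mono) (auto simp: \<delta>_def)
      moreover have "4 - real n \<le> \<delta> * 2" by (simp add: \<delta>_def max_def)
      ultimately show ?thesis using 2(4) by simp
    qed
  qed
  \<comment> \<open>Two roots of one all-positive clause are never true together; otherwise each is
    selected independently with probability 1/3.\<close>
  have ninth: "card {c \<in> choices. {fst p, snd p} \<subseteq> T c} \<le> card choices / 9" if p: "p \<in> Z" for p
  proof (cases "{c \<in> choices. {fst p, snd p} \<subseteq> T c} = {}")
    case True
    then show ?thesis by (simp only: card.empty)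
  next
    case False
    then obtain c where "c \<in> choices" "{fst p, snd p} \<subseteq> T c" by blast
    then have "card {c \<in> choices. {fst p, snd p} \<subseteq> T c} * (\<Prod>y\<in>{fst p, snd p}. branching y) \<le> card choices"
      by (rule card_T_fixed)
    moreover have "fst p \<noteq> snd p" "branching (fst p) = 3" "branching (snd p) = 3"
      using p branching_root_var by (auto simp: Z_def Cpair_def)
    ultimately have "card {c \<in> choices. {fst p, snd p} \<subseteq> T c} * 9 \<le> card choices" by simp
    then show ?thesis by linarith
  qed
  have "(\<Sum>c\<in>choices. real (card (N c))) = (\<Sum>c\<in>choices. \<Sum>p | p \<in> Z \<and> {fst p, snd p} \<subseteq> T c. 1)"
    by (simp add: N_def)
  also have "\<dots> = (\<Sum>p\<in>Z. \<Sum>c | c \<in> choices \<and> {fst p, snd p} \<subseteq> T c. 1)"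
    using finite_choices Z(1) by (rule sum.swap_restrict)
  also have "\<dots> = (\<Sum>p\<in>Z. real (card {c \<in> choices. {fst p, snd p} \<subseteq> T c}))"
    by simp
  also have "\<dots> \<le> (\<Sum>p\<in>Z. card choices / 9)" using ninth by (rule sum_mono)
  also have "\<dots> = card Z * (card choices / 9)" by simp
  also have "\<dots> \<le> (3 * n) * (card choices / 9)" using Z(2) by (intro mult_right_mono) auto
  finally have N: "(\<Sum>c\<in>choices. real (card (N c))) \<le> n * card choices / 3" by simp
  have "card choices * 22 \<le> (\<Sum>c\<in>choices. load c + \<delta> * card (N c))"
    using low by (simp add: sum_bounded_below)
  also have "\<dots> = (\<Sum>c\<in>choices. load c) + \<delta> * (\<Sum>c\<in>choices. real (card (N c)))"
    by (simp add: sum.distrib sum_distrib_left)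
  also have "\<dots> \<le> card choices * card F + \<delta> * (n * card choices / 3)"
    using sum_load_le N by (intro add_mono mult_left_mono) (auto simp: \<delta>_def)
  finally have "card choices * 22 \<le> card choices * (card F + \<delta> * n / 3)" by (simp add: algebra_simps)
  moreover have "card choices > 0" using finite_choices choices_nonempty by (simp add: card_gt_0_iff)
  ultimately have "22 \<le> card F + \<delta> * n / 3" by simp
  moreover have "\<delta> * n \<le> 2"
  proof -
    \<comment> \<open>Equivalent to \<open>(n - 2)^2 >= 0\<close>.\<close>
    have "(4 - real n) / 2 * n \<le> 2"
      using zero_le_power2[of "real n - 2"] by (simp add: power2_eq_square algebra_simps)
    then show ?thesis by (simp add: \<delta>_def max_def)
  qed
  \<comment> \<open>The loss is at most 2/3, so integrality restores the bound 22.\<close>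
  ultimately have "21 < real (card F)" by linarith
  then show ?thesis by linarith
qed

end

theorem theorem11: "\<mu> 3 1 3 \<ge> 22 \<and> \<mu> 3 1 4 \<ge> 19"
proof
  have l: "unsat_formula F q" if "kpq_formula 3 1 q F" "\<not> satisfiable F" for F :: "nat lit set set" and q
    using that by unfold_locales
  show "\<mu> 3 1 3 \<ge> 22" unfolding \<mu>_def
  proof (rule Inf_greatest)
    fix m assume "m \<in> {enat (card F) | F :: nat lit set set. kpq_formula 3 1 3 F \<and> \<not> satisfiable F}"
    then obtain F :: "nat lit set set" where F: "m = enat (card F)" "unsat_formula F 3" using l by blast
    then have "22 \<le> card F" using unsat_formula.card_F_ge_22 by blast
    then show "22 \<le> m" using F by (simp add: numeral_eq_enat)
  qed
  show "\<mu> 3 1 4 \<ge> 19" unfolding \<mu>_def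
  proof (rule Inf_greatest)
    fix m assume "m \<in> {enat (card F) | F :: nat lit set set. kpq_formula 3 1 4 F \<and> \<not> satisfiable F}"
    then obtain F :: "nat lit set set" where F: "m = enat (card F)" "unsat_formula F 4" using l by blast
    then have "19 \<le> card F" using unsat_formula.card_F_ge_19 by blast
    then show "19 \<le> m" using F by (simp add: numeral_eq_enat)
  qed
qed

end
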